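(* Let $\Delta\ge2$ and let $F=(V,E)$ be a loopless multigraph with maximum degree $\Delta(F)\le\Delta$ whose underlying simple graph $F_0$ is connected and has no induced subgraph isomorphic to $2K_2$. Then: (i) if $F$ is bipartite, then $|E|\le\Delta^2$, with equality iff $F$ is the (simple) complete bipartite graph $K_{\Delta,\Delta}$; (ii) if $\omega(F_0)=2$ and $F$ is not bipartite, then $|E|\le f(\Delta)$, with equality iff $F$ is isomorphic to $C_5(\Delta)$; (iii) if $\omega(F_0)\ge3$, then $|E|<f(\Delta)$.
   Context: Degrees count edge multiplicities; $|E|$ counts edges with multiplicity. The underlying simple graph $F_0$ has vertex set $V$ with $xy$ an edge iff $F$ has at least one edge between $x$ and $y$. $2K_2$ is the graph consisting of two disjoint edges. $\omega$ is the clique number. For even $\Delta\ge2$, $C_5(\Delta)$ is the simple graph obtained from the five-cycle by replacing each vertex by a stable set of size $\Delta/2$ (adjacent vertices of the cycle become complete bipartite pairs of stable sets, non-adjacent ones anticomplete). For odd $\Delta\ge3$, $C_5(\Delta)$ is obtained in the same way but replacing two consecutive vertices of the five-cycle by stable sets of size $(\Delta+1)/2$ and the other three by stable sets of size $(\Delta-1)/2$. $f(\Delta)$ is the number of edges of $C_5(\Delta)$: $f(\Delta)=5\Delta^2/4$ if $\Delta$ is even and $f(\Delta)=(5\Delta^2-2\Delta+1)/4$ if $\Delta$ is odd. *)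

theory Defs
  imports Main
begin

text \<open>A loopless multigraph is given by a finite vertex set V and a symmetric
multiplicity function m (number of edges between x and y), zero on the
diagonal and outside V.\<close>

definition loopless_multigraph :: "'a set \<Rightarrow> ('a \<Rightarrow> 'a \<Rightarrow> nat) \<Rightarrow> bool" where
  "loopless_multigraph V m \<longleftrightarrow> finite V \<and> (\<forall>x y. m x y = m y x) \<and> (\<forall>x. m x x = 0)
     \<and> (\<forall>x y. 0 < m x y \<longrightarrow> x \<in> V \<and> y \<in> V)"

definition mdeg :: "'a set \<Rightarrow> ('a \<Rightarrow> 'a \<Rightarrow> nat) \<Rightarrow> 'a \<Rightarrow> nat" where
  "mdeg V m x = (\<Sum>y\<in>V. m x y)"

definition num_edges :: "'a set \<Rightarrow> ('a \<Rightarrow> 'a \<Rightarrow> nat) \<Rightarrow> nat" where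
  "num_edges V m = (\<Sum>x\<in>V. \<Sum>y\<in>V. m x y) div 2"

definition adj :: "('a \<Rightarrow> 'a \<Rightarrow> nat) \<Rightarrow> 'a \<Rightarrow> 'a \<Rightarrow> bool" where
  "adj m x y \<longleftrightarrow> 0 < m x y"

definition connected_mg :: "'a set \<Rightarrow> ('a \<Rightarrow> 'a \<Rightarrow> nat) \<Rightarrow> bool" where
  "connected_mg V m \<longleftrightarrow> V \<noteq> {} \<and> (\<forall>x\<in>V. \<forall>y\<in>V. (adj m)\<^sup>*\<^sup>* x y)"

definition two_K2_free :: "'a set \<Rightarrow> ('a \<Rightarrow> 'a \<Rightarrow> nat) \<Rightarrow> bool" where
  "two_K2_free V m \<longleftrightarrow> \<not> (\<exists>a\<in>V. \<exists>b\<in>V. \<exists>c\<in>V. \<exists>d\<in>V. distinct [a,b,c,d] \<and>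
      adj m a b \<and> adj m c d \<and> \<not> adj m a c \<and> \<not> adj m a d \<and> \<not> adj m b c \<and> \<not> adj m b d)"

definition bipartite_mg :: "'a set \<Rightarrow> ('a \<Rightarrow> 'a \<Rightarrow> nat) \<Rightarrow> bool" where
  "bipartite_mg V m \<longleftrightarrow> (\<exists>A\<subseteq>V. \<forall>x\<in>V. \<forall>y\<in>V. adj m x y \<longrightarrow> (x \<in> A \<longleftrightarrow> y \<notin> A))"

definition is_clique :: "'a set \<Rightarrow> ('a \<Rightarrow> 'a \<Rightarrow> nat) \<Rightarrow> 'a set \<Rightarrow> bool" where
  "is_clique V m S \<longleftrightarrow> S \<subseteq> V \<and> (\<forall>x\<in>S. \<forall>y\<in>S. x \<noteq> y \<longrightarrow> adj m x y)"

definition clique_number :: "'a set \<Rightarrow> ('a \<Rightarrow> 'a \<Rightarrow> nat) \<Rightarrow> nat" where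
  "clique_number V m = Max {card S | S. is_clique V m S}"

definition mg_iso :: "'a set \<Rightarrow> ('a \<Rightarrow> 'a \<Rightarrow> nat) \<Rightarrow> 'b set \<Rightarrow> ('b \<Rightarrow> 'b \<Rightarrow> nat) \<Rightarrow> bool" where
  "mg_iso V m W m' \<longleftrightarrow> (\<exists>f. bij_betw f V W \<and> (\<forall>x\<in>V. \<forall>y\<in>V. m x y = m' (f x) (f y)))"

definition KDD_V :: "nat \<Rightarrow> (nat \<times> nat) set" where
  "KDD_V D = {(i,j). i < 2 \<and> j < D}"

definition KDD_m :: "nat \<Rightarrow> (nat \<times> nat) \<Rightarrow> (nat \<times> nat) \<Rightarrow> nat" where
  "KDD_m D u v = (if u \<in> KDD_V D \<and> v \<in> KDD_V D \<and> fst u \<noteq> fst v then 1 else 0)"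

definition c5_size :: "nat \<Rightarrow> nat \<Rightarrow> nat" where
  "c5_size D i = (if even D then D div 2 else if i < 2 then (D + 1) div 2 else (D - 1) div 2)"

definition C5_V :: "nat \<Rightarrow> (nat \<times> nat) set" where
  "C5_V D = {(i,j). i < 5 \<and> j < c5_size D i}"

definition C5_m :: "nat \<Rightarrow> (nat \<times> nat) \<Rightarrow> (nat \<times> nat) \<Rightarrow> nat" where
  "C5_m D u v = (if u \<in> C5_V D \<and> v \<in> C5_V D \<and>
       (fst u = (fst v + 1) mod 5 \<or> fst v = (fst u + 1) mod 5) then 1 else 0)"

definition fD :: "nat \<Rightarrow> nat" where
  "fD D = (if even D then 5 * D^2 div 4 else (5 * D^2 + 1 - 2 * D) div 4)"

end

(*
  If weights g satisfy g u + g v >= c on every edge, then c |E| <= D * sum g.  All bounds come from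
  such fractional vertex covers; with g = 1, c = 2 it suffices to bound |V|.

  With a triangle present one gets 4|E| <= 5 D^2 - 2 D.  A 2K2-free graph has a dominating clique
  of size at least 3.  A 5-clique K yields the cover by the numbers of neighbours in K.  A dominating
  4-clique either yields a dominating triangle or its neighbour counts minus one form a cover.  For
  a dominating triangle, some pair of its private neighbourhoods provides two further vertices such
  that every vertex has two neighbours among the five, whence 2|V| + 2 <= 5 D.

  A triangle-free non-bipartite graph is a blow-up of the five-cycle, and the degree bounds force
  the part sizes as soon as 2|V| + 1 >= 5 D.  In a bipartite graph each side is the neighbourhood of
  one vertex.
*)
theory Submission
  imports Defs
begin

section \<open>The extremal graphs\<close>

text \<open>The blown-up five-cycle has \<open>5 D / 2\<close> or \<open>(5 D - 1) / 2\<close>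
  vertices, so \<open>2 |V| + 2 <= 5 D\<close> says exactly that \<open>V\<close> is smaller than
  it. The obstacle is that a graph with a triangle may have more vertices: \<open>D - 2\<close>
  pendant vertices at each corner give \<open>3 D - 3\<close>. Such graphs have few edges, so the
  weight must vanish on those vertices. Counting neighbours in a small dominating clique
  \<open>K\<close> achieves this: the counts sum to at most \<open>|K| D\<close>, and lowering each
  by one makes a large \<open>V\<close> a gain. Multiplicities enter only through the degrees, until
  equality forces \<open>D\<close> distinct neighbours.\<close>

lemma mg_iso_num_edges:
  assumes "mg_iso V m W m'"
  shows "num_edges V m = num_edges W m'"
proof -
  obtain f where f: "bij_betw f V W" and m: "\<And>x y. x \<in> V \<Longrightarrow> y \<in> V \<Longrightarrow> m x y = m' (f x) (f y)"
    using assms by (auto simp: mg_iso_def)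
  have "(\<Sum>x\<in>V. \<Sum>y\<in>V. m x y) = (\<Sum>x\<in>V. \<Sum>y\<in>V. m' (f x) (f y))"
    by (intro sum.cong refl m)
  also have "\<dots> = (\<Sum>x\<in>V. \<Sum>y\<in>W. m' (f x) y)"
    by (intro sum.cong refl sum.reindex_bij_betw f)
  also have "\<dots> = (\<Sum>x\<in>W. \<Sum>y\<in>W. m' x y)"
    by (rule sum.reindex_bij_betw[OF f])
  finally show ?thesis
    by (simp add: num_edges_def)
qed

text \<open>Vertices with the same first component are twins, so the double sum over
  \<open>W\<close> collapses to one over pairs of classes, weighted by their sizes. This serves
  \<open>KDD_m\<close> and \<open>C5_m\<close> alike.\<close>

lemma num_edges_blow_up:
  fixes s :: "nat \<Rightarrow> nat"
  assumes W: "W = {(i, j). i < k \<and> j < s i}"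
    and m: "\<And>u v. u \<in> W \<Longrightarrow> v \<in> W \<Longrightarrow> m u v = of_bool (R (fst u) (fst v))"
  shows "num_edges W m = (\<Sum>i<k. \<Sum>j<k. s i * s j * of_bool (R i j)) div 2"
proof -
  have W': "W = Sigma {..<k} (\<lambda>i. {..<s i})"
    using W by auto
  have sum_W: "(\<Sum>u\<in>W. F (fst u)) = (\<Sum>i<k. s i * F i)" for F :: "nat \<Rightarrow> nat"
  proof -
    have "(\<Sum>u\<in>W. F (fst u)) = (\<Sum>(i, j)\<in>Sigma {..<k} (\<lambda>i. {..<s i}). F i)"
      by (simp add: W' split_def)
    also have "\<dots> = (\<Sum>i<k. \<Sum>j<s i. F i)"
      by (rule sum.Sigma[symmetric]) auto
    finally show ?thesis by simp
  qed
  have "(\<Sum>u\<in>W. \<Sum>v\<in>W. m u v) = (\<Sum>u\<in>W. \<Sum>v\<in>W. of_bool (R (fst u) (fst v)))"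
    by (intro sum.cong refl m)
  also have "\<dots> = (\<Sum>i<k. s i * (\<Sum>j<k. s j * of_bool (R i j)))"
    by (simp only: sum_W[where F = "\<lambda>j. of_bool (R _ j)"] sum_W[where F = "\<lambda>i. \<Sum>j<k. s j * of_bool (R i j)"])
  finally show ?thesis
    by (simp only: num_edges_def sum_distrib_left mult.assoc)
qed

lemma lessThan_two: "{..<2::nat} = {0, 1}"
  by auto

lemma num_edges_KDD: "num_edges (KDD_V D) (KDD_m D) = D\<^sup>2"
proof -
  have "num_edges (KDD_V D) (KDD_m D) = (\<Sum>i<2. \<Sum>j<(2::nat). D * D * of_bool (i \<noteq> j)) div 2"
    by (rule num_edges_blow_up) (auto simp: KDD_V_def KDD_m_def)
  also have "\<dots> = D\<^sup>2"
    by (simp add: lessThan_two power2_eq_square flip: mult_2)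
  finally show ?thesis .
qed

definition consecutive :: "nat \<Rightarrow> nat \<Rightarrow> bool" where
  "consecutive i j \<longleftrightarrow> i = (j + 1) mod 5 \<or> j = (i + 1) mod 5"

lemma lessThan_five: "{..<5::nat} = {0, 1, 2, 3, 4}"
  by auto

lemma num_edges_C5: "num_edges (C5_V D) (C5_m D) = fD D"
proof -
  have "num_edges (C5_V D) (C5_m D)
      = (\<Sum>i<5. \<Sum>j<5. c5_size D i * c5_size D j * of_bool (consecutive i j)) div 2"
    by (rule num_edges_blow_up) (auto simp: C5_V_def C5_m_def consecutive_def)
  also have "\<dots> = fD D"
  proof (cases "even D")
    case True
    then obtain k where "D = 2 * k" by blast
    then show ?thesis
      by (simp add: lessThan_five c5_size_def consecutive_def fD_def power2_eq_square)
  next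
    case False
    then obtain k where D: "D = 2 * k + 1" by (elim oddE)
    have "5 * D\<^sup>2 + 1 - 2 * D = 4 * (5 * k\<^sup>2 + 4 * k + 1)"
      unfolding D by (simp add: power2_eq_square algebra_simps)
    then have "fD D = 5 * k\<^sup>2 + 4 * k + 1"
      using False by (simp add: fD_def)
    moreover have "(\<Sum>i<5. \<Sum>j<5. c5_size D i * c5_size D j * of_bool (consecutive i j))
      = 2 * (5 * k\<^sup>2 + 4 * k + 1)"
      unfolding D
      by (simp add: lessThan_five c5_size_def consecutive_def power2_eq_square algebra_simps)
    ultimately show ?thesis by simp
  qed
  finally show ?thesis .
qed

text \<open>The bound is calibrated to odd \<open>D\<close>, where
  \<open>4 * fD D = 5 * D^2 - 2 * D + 1\<close> and equality is missed by one. For even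
  \<open>D\<close> there is a gap of \<open>2 * D\<close>.\<close>

lemma less_fD:
  assumes "2 \<le> D" "4 * e + 2 * D \<le> 5 * D\<^sup>2"
  shows "e < fD D"
proof (cases "even D")
  case True
  then obtain k where D: "D = 2 * k" by blast
  have "fD D = 5 * k\<^sup>2"
    unfolding D by (simp add: fD_def power2_eq_square)
  moreover have "4 * e + 4 * k \<le> 20 * k\<^sup>2"
    using assms(2) unfolding D by (simp add: power2_eq_square)
  ultimately show ?thesis using assms(1) D by linarith
next
  case False
  then obtain k where D: "D = 2 * k + 1" by (elim oddE)
  have "5 * D\<^sup>2 + 1 - 2 * D = 4 * (5 * k\<^sup>2 + 4 * k + 1)" "5 * D\<^sup>2 = 20 * k\<^sup>2 + 20 * k + 5"
    unfolding D by (simp_all add: power2_eq_square algebra_simps)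
  then have "fD D = 5 * k\<^sup>2 + 4 * k + 1" "4 * e + 2 * D \<le> 20 * k\<^sup>2 + 20 * k + 5"
    using False assms(2) by (simp_all add: fD_def)
  then show ?thesis using D by linarith
qed

text \<open>Vertices of one class are interchangeable in both extremal graphs, so any numbering
  inside the classes yields an isomorphism; adjacency there only looks at
  \<open>fst (f v)\<close>.\<close>

lemma class_bijection:
  fixes s h
  assumes "finite V" and "\<And>v. v \<in> V \<Longrightarrow> h v < k"
    and "\<And>i. i < k \<Longrightarrow> card {v \<in> V. h v = i} = s i"
  obtains f where "bij_betw f V {(i, j). i < k \<and> j < s i}" "\<And>v. v \<in> V \<Longrightarrow> fst (f v) = h v"
proof -
  have "\<exists>g. bij_betw g {v \<in> V. h v = i} {..<s i}" if "i < k" for i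
    using assms that by (intro finite_same_card_bij) auto
  then obtain g where g: "\<And>i. i < k \<Longrightarrow> bij_betw (g i) {v \<in> V. h v = i} {..<s i}"
    by metis
  define f where "f v = (h v, g (h v) v)" for v
  have "bij_betw f V {(i, j). i < k \<and> j < s i}"
    unfolding bij_betw_def
  proof
    show "inj_on f V"
    proof (rule inj_onI)
      fix u v assume uv: "u \<in> V" "v \<in> V" "f u = f v"
      then show "u = v"
        using bij_betw_imp_inj_on[OF g[OF assms(2)[OF uv(1)]]] by (auto simp: f_def inj_on_def)
    qed
    show "f ` V = {(i, j). i < k \<and> j < s i}"
    proof
      show "f ` V \<subseteq> {(i, j). i < k \<and> j < s i}"
        using assms(2) bij_betwE[OF g] by (auto simp: f_def)
      show "{(i, j). i < k \<and> j < s i} \<subseteq> f ` V"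
      proof clarify
        fix i j assume "i < k" "j < s i"
        then have "j \<in> g i ` {v \<in> V. h v = i}"
          using bij_betw_imp_surj_on[OF g] by blast
        then show "(i, j) \<in> f ` V"
          by (auto simp: f_def)
      qed
    qed
  qed
  then show ?thesis
    by (rule that) (simp add: f_def)
qed

section \<open>Multigraphs whose underlying graph is connected and free of induced 2K2\<close>

locale two_K2_free_mg =
  fixes V :: "'a set" and m :: "'a \<Rightarrow> 'a \<Rightarrow> nat" and D :: nat
  assumes multigraph: "loopless_multigraph V m"
    and mdeg_le: "x \<in> V \<Longrightarrow> mdeg V m x \<le> D"
    and conn: "connected_mg V m"
    and K2_free: "two_K2_free V m"
begin

abbreviation edge (infix "\<sim>" 50) where "x \<sim> y \<equiv> adj m x y"

definition nb :: "'a \<Rightarrow> 'a set" where "nb x = {y \<in> V. x \<sim> y}"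

lemma finite_V [simp]: "finite V"
  using multigraph by (simp add: loopless_multigraph_def)

lemma m_commute: "m x y = m y x"
  using multigraph by (simp add: loopless_multigraph_def)

lemma edge_sym: "x \<sim> y \<longleftrightarrow> y \<sim> x"
  by (simp add: adj_def m_commute)

lemma edge_irrefl [simp]: "\<not> x \<sim> x"
  using multigraph by (simp add: loopless_multigraph_def adj_def)

lemma edge_in_V: "x \<sim> y \<Longrightarrow> x \<in> V \<and> y \<in> V"
  using multigraph by (auto simp: loopless_multigraph_def adj_def)

lemma in_nb [simp]: "y \<in> nb x \<longleftrightarrow> x \<sim> y"
  using edge_in_V by (auto simp: nb_def)

lemma finite_nb [simp]: "finite (nb x)"
  by (simp add: nb_def)

text \<open>Coinciding endpoints are covered as well: a shared vertex of the two edges itself yields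
  one of the four adjacencies.\<close>

lemma no_2K2:
  assumes "a \<sim> b" "c \<sim> d"
  shows "a \<sim> c \<or> a \<sim> d \<or> b \<sim> c \<or> b \<sim> d"
proof (rule ccontr)
  assume neg: "\<not> ?thesis"
  have "distinct [a, b, c, d]"
    using assms neg edge_sym by auto
  with neg assms edge_in_V show False
    using K2_free unfolding two_K2_free_def by blast
qed

lemma edge_leaving:
  assumes "W \<subseteq> V" "y \<in> W" "z \<in> V - W"
  shows "\<exists>a\<in>W. \<exists>b\<in>V - W. a \<sim> b"
proof (rule ccontr)
  assume neg: "\<not> ?thesis"
  have "(adj m)\<^sup>*\<^sup>* y z"
    using conn assms by (auto simp: connected_mg_def)
  then have "z \<in> W"
  proof (induction rule: rtranclp_induct)
    case base
    show ?case by fact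
  next
    case (step b c)
    then show ?case using neg edge_in_V[of b c] by blast
  qed
  with assms show False by simp
qed

subsection \<open>Degree counting\<close>

text \<open>Each edge charges the weights of its ends, so a vertex pays its weight once per incident
  edge. The degrees are kept because the bipartite case must detect a vertex of degree below
  \<open>D\<close> on one side.\<close>

lemma num_edges_le_weighted:
  assumes "\<And>x y. x \<sim> y \<Longrightarrow> c \<le> g x + g y"
  shows "c * num_edges V m \<le> (\<Sum>x\<in>V. g x * mdeg V m x)"
proof -
  define T where "T = (\<Sum>x\<in>V. \<Sum>y\<in>V. m x y)"
  have *: "c * m x y \<le> (g x + g y) * m x y" for x y
    using assms[of x y] by (cases "m x y = 0") (auto simp: adj_def)
  have "c * T \<le> (\<Sum>x\<in>V. \<Sum>y\<in>V. (g x + g y) * m x y)"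
    unfolding T_def sum_distrib_left by (intro sum_mono *)
  also have "\<dots> = (\<Sum>x\<in>V. \<Sum>y\<in>V. g x * m x y) + (\<Sum>x\<in>V. \<Sum>y\<in>V. g y * m x y)"
    by (simp add: sum.distrib algebra_simps)
  also have "(\<Sum>x\<in>V. \<Sum>y\<in>V. g y * m x y) = (\<Sum>x\<in>V. \<Sum>y\<in>V. g x * m x y)"
    by (subst sum.swap) (simp add: m_commute)
  finally have "c * T \<le> 2 * (\<Sum>x\<in>V. g x * mdeg V m x)"
    by (simp add: mdeg_def sum_distrib_left mult_2 sum.distrib)
  \<comment> \<open>Rounding down in \<open>T div 2\<close> only helps an upper bound, so the parity
    of \<open>T\<close> need not be discussed.\<close>
  moreover have "2 * (c * (T div 2)) \<le> c * T"
    using mult_le_mono2[of "2 * (T div 2)" T c] by (simp add: mult.left_commute)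
  ultimately have "c * (T div 2) \<le> (\<Sum>x\<in>V. g x * mdeg V m x)"
    by linarith
  then show ?thesis
    by (simp only: num_edges_def T_def)
qed

lemma num_edges_le_cover:
  assumes "\<And>x y. x \<sim> y \<Longrightarrow> c \<le> g x + g y"
  shows "c * num_edges V m \<le> D * (\<Sum>x\<in>V. g x)"
proof -
  have "(\<Sum>x\<in>V. g x * mdeg V m x) \<le> (\<Sum>x\<in>V. g x * D)"
    by (intro sum_mono mult_le_mono2 mdeg_le)
  also have "\<dots> = D * (\<Sum>x\<in>V. g x)"
    by (simp add: sum_distrib_left mult.commute)
  finally show ?thesis
    using num_edges_le_weighted[of c g] assms by fastforce
qed

lemma num_edges_le_card: "2 * num_edges V m \<le> D * card V"
  using num_edges_le_cover[of 2 "\<lambda>_. 1"] by simp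

lemma card_nb_le_mdeg: "card (nb x) \<le> mdeg V m x"
proof -
  have "card (nb x) = (\<Sum>y\<in>V. of_bool (x \<sim> y))"
    by (simp add: nb_def Int_def)
  also have "\<dots> \<le> mdeg V m x"
    unfolding mdeg_def by (intro sum_mono) (auto simp: adj_def)
  finally show ?thesis .
qed

lemma card_nb_le: "x \<in> V \<Longrightarrow> card (nb x) \<le> D"
  using card_nb_le_mdeg mdeg_le order_trans by blast

text \<open>\<open>D\<close> distinct neighbours already exhaust the degree, so a parallel edge
  would exceed it. This makes the extremal multigraphs simple.\<close>

lemma multiplicity_one:
  assumes "x \<in> V" "D \<le> card (nb x)" "x \<sim> y"
  shows "m x y = 1"
proof (rule ccontr)
  assume ne: "m x y \<noteq> 1"
  have "card (nb x) = (\<Sum>y\<in>V. of_bool (x \<sim> y))"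
    by (simp add: nb_def Int_def)
  also have "\<dots> < mdeg V m x"
    unfolding mdeg_def
  proof (intro sum_strict_mono_strong[of _ y])
    show "(of_bool (x \<sim> y) :: nat) < m x y"
      using assms ne by (auto simp: adj_def)
  qed (use assms edge_in_V in \<open>auto simp: adj_def\<close>)
  finally show False
    using mdeg_le[OF \<open>x \<in> V\<close>] assms by linarith
qed

lemma sum_card_nb_Int:
  assumes "S \<subseteq> V"
  shows "(\<Sum>v\<in>V. card (nb v \<inter> S)) = (\<Sum>s\<in>S. card (nb s))"
proof -
  have "finite S" using assms finite_subset finite_V by blast
  then have "card (nb v \<inter> S) = (\<Sum>s\<in>S. of_bool (v \<sim> s))" for v
    by (simp add: Int_def conj_commute)
  moreover have "card (nb s) = (\<Sum>v\<in>V. of_bool (v \<sim> s))" for s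
    by (simp add: nb_def Int_def edge_sym)
  ultimately show ?thesis
    by (simp only: sum.swap[of _ S V])
qed

text \<open>If every vertex has at least \<open>k\<close> neighbours in \<open>S\<close>, this gives
  \<open>k |V| <= |S| D\<close>. Surplus neighbours of single vertices sharpen it, and the
  \<open>+ 2\<close> in the vertex bounds below comes from there.\<close>

lemma sum_card_nb_Int_le:
  assumes "S \<subseteq> V"
  shows "(\<Sum>v\<in>V. card (nb v \<inter> S)) \<le> card S * D"
proof -
  have "(\<Sum>s\<in>S. card (nb s)) \<le> of_nat (card S) * D"
    using assms card_nb_le by (intro sum_bounded_above) blast
  then show ?thesis
    by (simp add: sum_card_nb_Int[OF assms])
qed

lemma two_le_card_nb_Int:
  assumes "v \<sim> a" "v \<sim> b" "a \<noteq> b" "a \<in> S" "b \<in> S"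
  shows "2 \<le> card (nb v \<inter> S)"
  using card_mono[of "nb v \<inter> S" "{a, b}"] assms by simp

lemma three_le_card_nb_Int:
  assumes "v \<sim> a" "v \<sim> b" "v \<sim> c" "distinct [a, b, c]" "{a, b, c} \<subseteq> S"
  shows "3 \<le> card (nb v \<inter> S)"
  using card_mono[of "nb v \<inter> S" "{a, b, c}"] assms by simp

text \<open>Between two stable sets the neighbourhoods are nested, so one vertex sees everything that
  is seen at all.\<close>

lemma nested_dominator:
  assumes X: "X \<subseteq> V" "X \<noteq> {}" "\<And>a b. a \<in> X \<Longrightarrow> b \<in> X \<Longrightarrow> \<not> a \<sim> b"
    and Y: "\<And>a b. a \<in> Y \<Longrightarrow> b \<in> Y \<Longrightarrow> \<not> a \<sim> b"
    and XY: "\<And>y. y \<in> Y \<Longrightarrow> \<exists>x\<in>X. y \<sim> x"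
  shows "\<exists>p\<in>X. \<forall>y\<in>Y. p \<sim> y"
proof -
  have "finite X" using X finite_subset finite_V by blast
  then have "Max ((\<lambda>x. card (nb x \<inter> Y)) ` X) \<in> (\<lambda>x. card (nb x \<inter> Y)) ` X"
    using X(2) by (intro Max_in) auto
  then obtain p where p: "p \<in> X" "Max ((\<lambda>x. card (nb x \<inter> Y)) ` X) = card (nb p \<inter> Y)"
    by blast
  have max: "card (nb x \<inter> Y) \<le> card (nb p \<inter> Y)" if "x \<in> X" for x
    using Max_ge[of "(\<lambda>x. card (nb x \<inter> Y)) ` X" "card (nb x \<inter> Y)"] that p \<open>finite X\<close> by auto
  have "p \<sim> z" if z: "z \<in> Y" for z
  proof (rule ccontr)
    assume nz: "\<not> p \<sim> z"
    obtain p' where p': "p' \<in> X" "z \<sim> p'" using XY z by blast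
    \<comment> \<open>By maximality some \<open>y\<close> in \<open>Y\<close> is seen by
      \<open>p\<close> but not by \<open>p'\<close>; then \<open>p y\<close> and \<open>p' z\<close>
      form an induced 2K2.\<close>
    have "\<not> nb p \<inter> Y \<subset> nb p' \<inter> Y"
      using max[OF p'(1)] psubset_card_mono[of "nb p' \<inter> Y" "nb p \<inter> Y"] by auto
    moreover have "z \<in> nb p' \<inter> Y" "z \<notin> nb p"
      using p' z nz edge_sym by auto
    ultimately have "\<not> nb p \<inter> Y \<subseteq> nb p' \<inter> Y"
      by blast
    then obtain y where y: "y \<in> Y" "p \<sim> y" "\<not> p' \<sim> y"
      by (meson Int_iff in_nb subsetI)
    then show False
      using no_2K2[of p y p' z] p p' X(3) Y nz z edge_sym by blast
  qed
  with p show ?thesis by blast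
qed

subsection \<open>Dominating triangles\<close>

definition dominating_triangle :: "'a \<Rightarrow> 'a \<Rightarrow> 'a \<Rightarrow> bool" where
  "dominating_triangle x y z \<longleftrightarrow>
     x \<sim> y \<and> x \<sim> z \<and> y \<sim> z \<and> (\<forall>v\<in>V. v \<sim> x \<or> v \<sim> y \<or> v \<sim> z)"

definition priv :: "'a \<Rightarrow> 'a \<Rightarrow> 'a \<Rightarrow> 'a set" where
  "priv x y z = {v \<in> V. v \<sim> x \<and> \<not> v \<sim> y \<and> \<not> v \<sim> z}"

lemma dominating_triangle_rotate: "dominating_triangle x y z \<Longrightarrow> dominating_triangle y z x"
  unfolding dominating_triangle_def using edge_sym by blast

lemma priv_swap: "priv x y z = priv x z y"
  by (auto simp: priv_def)

lemma priv_in_V: "v \<in> priv x y z \<Longrightarrow> v \<in> V"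
  by (simp add: priv_def)

text \<open>An edge inside the set would form an induced 2K2 with \<open>y z\<close>.\<close>

lemma priv_stable: "y \<sim> z \<Longrightarrow> u \<in> priv x y z \<Longrightarrow> v \<in> priv x y z \<Longrightarrow> \<not> u \<sim> v"
  using no_2K2[of u v y z] by (auto simp: priv_def)

text \<open>Compare the edges \<open>u v\<close> and \<open>w x\<close>: \<open>u\<close> and
  \<open>v\<close> are private to \<open>y\<close> and \<open>z\<close>, so neither sees
  \<open>x\<close>.\<close>

lemma priv_cover:
  assumes "u \<in> priv y x z" "v \<in> priv z x y" "u \<sim> v" "w \<in> priv x y z"
  shows "w \<sim> u \<or> w \<sim> v"
  using assms no_2K2[of w x u v] edge_sym by (auto simp: priv_def)

section \<open>Vertex and edge counts from private neighbourhoods\<close>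

lemma priv_empty_card_le:
  assumes "dominating_triangle x y z" "priv z x y = {}"
  shows "card V \<le> 2 * D"
proof -
  have "V \<subseteq> nb x \<union> nb y"
    using assms edge_sym by (fastforce simp: dominating_triangle_def priv_def)
  then have "card V \<le> card (nb x \<union> nb y)"
    by (intro card_mono) auto
  also have "\<dots> \<le> card (nb x) + card (nb y)"
    by (rule card_Un_le)
  also have "\<dots> \<le> 2 * D"
    using card_nb_le[of x] card_nb_le[of y] assms edge_in_V
    by (fastforce simp: dominating_triangle_def)
  finally show ?thesis .
qed

lemma dominating_triangle_sum_le:
  assumes "dominating_triangle x y z"
  shows "(\<Sum>v\<in>V. card (nb v \<inter> {x, y, z})) \<le> 3 * D"
proof -
  have "x \<noteq> y" "x \<noteq> z" "y \<noteq> z"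
    using assms by (auto simp: dominating_triangle_def)
  then have "{x, y, z} \<subseteq> V" "card {x, y, z} = 3"
    using assms edge_in_V by (auto simp: dominating_triangle_def)
  then show ?thesis
    using sum_card_nb_Int_le[of "{x, y, z}"] by simp
qed

lemma dominating_triangle_one_le:
  assumes "dominating_triangle x y z" "v \<in> V"
  shows "1 \<le> card (nb v \<inter> {x, y, z})"
proof -
  have "nb v \<inter> {x, y, z} \<noteq> {}"
    using assms by (auto simp: dominating_triangle_def)
  then show ?thesis
    by (metis One_nat_def Suc_leI card_gt_0_iff finite_Int finite_nb)
qed

lemma dominating_triangle_two_le:
  assumes "dominating_triangle x y z" "v \<in> V"
    and "v \<notin> priv x y z" "v \<notin> priv y x z" "v \<notin> priv z x y"
  shows "2 \<le> card (nb v \<inter> {x, y, z})"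
proof -
  have "x \<noteq> y" "x \<noteq> z" "y \<noteq> z"
    using assms by (auto simp: dominating_triangle_def)
  moreover have "v \<sim> x \<and> v \<sim> y \<or> v \<sim> x \<and> v \<sim> z \<or> v \<sim> y \<and> v \<sim> z"
    using assms by (auto simp: dominating_triangle_def priv_def)
  ultimately show ?thesis
    using two_le_card_nb_Int[of v x y "{x, y, z}"] two_le_card_nb_Int[of v x z "{x, y, z}"]
      two_le_card_nb_Int[of v y z "{x, y, z}"] by auto
qed

text \<open>The weight is the number of corners seen minus one. It vanishes only on private
  vertices, so independence makes it a cover. Its sum is at most \<open>3 * D - card V\<close>,
  which is useful when \<open>V\<close> is large.\<close>

lemma priv_independent_num_edges:
  assumes tri: "dominating_triangle x y z" and "2 \<le> D"
    and indep: "\<And>u v. u \<in> priv x y z \<union> priv y x z \<union> priv z x y \<Longrightarrow>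
      v \<in> priv x y z \<union> priv y x z \<union> priv z x y \<Longrightarrow> \<not> u \<sim> v"
  shows "4 * num_edges V m + 2 * D \<le> 5 * D\<^sup>2"
proof -
  define g where "g v = card (nb v \<inter> {x, y, z}) - 1" for v
  have "1 \<le> g u + g v" if "u \<sim> v" for u v
  proof -
    have "u \<notin> priv x y z \<union> priv y x z \<union> priv z x y \<or> v \<notin> priv x y z \<union> priv y x z \<union> priv z x y"
      using indep that by blast
    then have "2 \<le> card (nb u \<inter> {x, y, z}) \<or> 2 \<le> card (nb v \<inter> {x, y, z})"
      using dominating_triangle_two_le[OF tri, of u] dominating_triangle_two_le[OF tri, of v]
        edge_in_V[OF that] by blast
    then show ?thesis
      by (auto simp: g_def)
  qed
  then have "1 * num_edges V m \<le> D * (\<Sum>v\<in>V. g v)"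
    by (rule num_edges_le_cover)
  moreover have "(\<Sum>v\<in>V. g v) + card V = (\<Sum>v\<in>V. g v + 1)"
    by (simp only: sum.distrib card_eq_sum)
  moreover have "(\<Sum>v\<in>V. g v + 1) = (\<Sum>v\<in>V. card (nb v \<inter> {x, y, z}))"
    unfolding g_def by (intro sum.cong refl le_add_diff_inverse2 dominating_triangle_one_le[OF tri])
  moreover have "\<dots> \<le> 3 * D"
    by (rule dominating_triangle_sum_le[OF tri])
  ultimately have e1: "num_edges V m \<le> D * (3 * D - card V)"
    by (metis add_le_imp_le_diff le_trans mult_1 mult_le_mono2)
  have e2: "2 * num_edges V m \<le> D * card V"
    by (rule num_edges_le_card)
  \<comment> \<open>For small \<open>V\<close> the plain bound
    \<open>2 * num_edges V m <= D * card V\<close> suffices; otherwise \<open>3 * D - card V\<close>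
    is at most \<open>(D + 1) / 2\<close>.\<close>
  show ?thesis
  proof (cases "2 * card V + 2 \<le> 5 * D")
    case True
    have "D * (2 * card V + 2) \<le> D * (5 * D)"
      using True by (rule mult_le_mono2)
    with e2 show ?thesis
      by (simp add: power2_eq_square algebra_simps)
  next
    case False
    then have "2 * (3 * D - card V) \<le> D + 1" by linarith
    then have "2 * (D * (3 * D - card V)) \<le> D * (D + 1)"
      by (metis mult.left_commute mult_le_mono2)
    with e1 have "4 * num_edges V m \<le> 2 * (D * (D + 1))" by linarith
    moreover have "2 * D \<le> D * D"
      using \<open>2 \<le> D\<close> by (rule mult_le_mono1)
    ultimately show ?thesis
      unfolding power2_eq_square distrib_left by linarith
  qed
qed

text \<open>The two outer sets together are stable, so one \<open>p\<close> in
  \<open>priv x y z\<close> sees both. What escapes \<open>nb x\<close> and \<open>nb p\<close> lies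
  in \<open>B\<close>, whence \<open>card V <= 2 * D + card B\<close>. But each member of
  \<open>B\<close> sees two corners and costs extra in the count of at most \<open>3 * D\<close>.
  Adding the two inequalities cancels \<open>card B\<close>.\<close>

lemma priv_star_card_le:
  assumes tri: "dominating_triangle x y z" and ne: "priv x y z \<noteq> {}"
    and indep: "\<And>u v. u \<in> priv y x z \<Longrightarrow> v \<in> priv z x y \<Longrightarrow> \<not> u \<sim> v"
    and star: "\<And>v. v \<in> priv y x z \<union> priv z x y \<Longrightarrow> \<exists>u\<in>priv x y z. v \<sim> u"
  shows "2 * card V + 2 \<le> 5 * D"
proof -
  have adj: "x \<sim> y" "x \<sim> z" "y \<sim> z" "y \<sim> x" "z \<sim> x" "z \<sim> y"
    using tri edge_sym by (auto simp: dominating_triangle_def)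
  have stable: "\<not> a \<sim> b" if "a \<in> priv y x z \<union> priv z x y" "b \<in> priv y x z \<union> priv z x y" for a b
    using that indep[of a b] indep[of b a] priv_stable[of x z a y b] priv_stable[of x y a z b]
      adj edge_sym[of a b] by blast
  have "\<exists>p\<in>priv x y z. \<forall>v\<in>priv y x z \<union> priv z x y. p \<sim> v"
    using ne stable star priv_stable[OF adj(3)] priv_in_V by (intro nested_dominator subsetI)
  then obtain p where p: "p \<in> priv x y z" "\<And>v. v \<in> priv y x z \<union> priv z x y \<Longrightarrow> p \<sim> v"
    by blast
  define B where "B = {v \<in> V. v \<sim> y \<and> v \<sim> z \<and> \<not> v \<sim> x}"
  have "B \<subseteq> V"
    by (auto simp: B_def)
  have "V \<subseteq> nb x \<union> nb p \<union> B"
  proof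
    fix v assume "v \<in> V"
    then have "v \<sim> x \<or> v \<in> priv y x z \<union> priv z x y \<or> v \<in> B"
      using tri by (auto simp: dominating_triangle_def priv_def B_def)
    then show "v \<in> nb x \<union> nb p \<union> B"
      using p edge_sym[of v x] by auto
  qed
  then have "card V \<le> card (nb x \<union> nb p \<union> B)"
    by (intro card_mono) (auto simp: B_def)
  also have "\<dots> \<le> card (nb x) + card (nb p) + card B"
    by (meson add_le_mono1 card_Un_le le_trans)
  also have "\<dots> \<le> 2 * D + card B"
    using card_nb_le[of x] card_nb_le[of p] edge_in_V[OF adj(1)] priv_in_V[OF p(1)] by auto
  finally have 1: "card V \<le> 2 * D + card B" .
  \<comment> \<open>\<open>x\<close> belongs to \<open>B\<close>, while \<open>y\<close> and
    \<open>z\<close> do not; these two also see two corners each, hence the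
    \<open>+ 2\<close>.\<close>
  have "card V + card B + 2 = (\<Sum>v\<in>V. 1 + of_bool (v \<in> B) + of_bool (v = y) + of_bool (v = z))"
    unfolding sum.distrib using edge_in_V[OF adj(3)] \<open>B \<subseteq> V\<close> by (simp add: Int_absorb1)
  also have "\<dots> \<le> (\<Sum>v\<in>V. card (nb v \<inter> {x, y, z}))"
  proof (rule sum_mono)
    fix v assume v: "v \<in> V"
    show "1 + of_bool (v \<in> B) + of_bool (v = y) + of_bool (v = z) \<le> card (nb v \<inter> {x, y, z})"
    proof (cases "v \<in> B \<or> v = y \<or> v = z")
      case True
      then have "(of_bool (v \<in> B) + of_bool (v = y) + of_bool (v = z) :: nat) = 1"
        using adj by (auto simp: B_def)
      moreover have "2 \<le> card (nb v \<inter> {x, y, z})"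
        using True v adj by (intro dominating_triangle_two_le[OF tri]) (auto simp: B_def priv_def)
      ultimately show ?thesis by linarith
    next
      case False
      then show ?thesis
        using dominating_triangle_one_le[OF tri v] by simp
    qed
  qed
  also have "\<dots> \<le> 3 * D"
    by (rule dominating_triangle_sum_le[OF tri])
  finally show ?thesis
    using 1 by linarith
qed

text \<open>Adding dominators \<open>p\<close>, \<open>q\<close> of the two private sets to the triangle gives a set of five
  vertices in which every vertex has at least two neighbours.\<close>

lemma priv_mutual_card_le:
  assumes tri: "dominating_triangle x y z"
    and ne: "priv y x z \<noteq> {}" "priv z x y \<noteq> {}"
    and yz: "\<And>v. v \<in> priv y x z \<Longrightarrow> \<exists>u\<in>priv z x y. v \<sim> u"
    and zy: "\<And>v. v \<in> priv z x y \<Longrightarrow> \<exists>u\<in>priv y x z. v \<sim> u"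
  shows "2 * card V + 2 \<le> 5 * D"
proof -
  have adj: "x \<sim> y" "x \<sim> z" "y \<sim> z" "y \<sim> x" "z \<sim> x" "z \<sim> y"
    using tri edge_sym by (auto simp: dominating_triangle_def)
  note stable = priv_stable[OF adj(2)] priv_stable[OF adj(1)]
  have "\<exists>p\<in>priv y x z. \<forall>v\<in>priv z x y. p \<sim> v"
    using ne zy stable priv_in_V by (intro nested_dominator subsetI)
  then obtain p where p: "p \<in> priv y x z" "\<And>v. v \<in> priv z x y \<Longrightarrow> p \<sim> v"
    by blast
  have "\<exists>q\<in>priv z x y. \<forall>v\<in>priv y x z. q \<sim> v"
    using ne yz stable priv_in_V by (intro nested_dominator subsetI)
  then obtain q where q: "q \<in> priv z x y" "\<And>v. v \<in> priv y x z \<Longrightarrow> q \<sim> v"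
    by blast
  define S where "S = {x, y, z, p, q}"
  have pq: "p \<sim> y" "\<not> p \<sim> x" "\<not> p \<sim> z" "q \<sim> z" "\<not> q \<sim> x" "\<not> q \<sim> y" "p \<sim> q"
    using p q by (auto simp: priv_def)
  have dist: "distinct [x, y, z, p, q]"
    using adj pq edge_sym[of p q] by auto
  have "S \<subseteq> V" "card S = 5"
    using dist adj p q edge_in_V priv_in_V by (auto simp: S_def)
  \<comment> \<open>The \<open>+ 2\<close>: \<open>y\<close> sees \<open>x\<close>,
    \<open>z\<close>, \<open>p\<close>, and \<open>z\<close> sees \<open>x\<close>,
    \<open>y\<close>, \<open>q\<close>, one more than the two demanded of every vertex.\<close>
  have "2 * card V + 2 = (\<Sum>v\<in>V. 2 + of_bool (v = y) + of_bool (v = z))"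
    unfolding sum.distrib using edge_in_V[OF adj(3)] by simp
  also have "\<dots> \<le> (\<Sum>v\<in>V. card (nb v \<inter> S))"
  proof (rule sum_mono)
    fix v assume v: "v \<in> V"
    show "2 + of_bool (v = y) + of_bool (v = z) \<le> card (nb v \<inter> S)"
    proof (cases "v = y \<or> v = z")
      case True
      then show ?thesis
        using three_le_card_nb_Int[of y x z p S] three_le_card_nb_Int[of z x y q S] dist adj pq
          edge_sym[of p y] edge_sym[of q z] by (auto simp: S_def)
    next
      case False
      have "\<exists>a\<in>S. \<exists>b\<in>S. v \<sim> a \<and> v \<sim> b \<and> a \<noteq> b"
      proof -
        consider "v \<in> priv x y z" | "v \<in> priv y x z" | "v \<in> priv z x y"
          | "v \<sim> x \<and> v \<sim> y \<or> v \<sim> x \<and> v \<sim> z \<or> v \<sim> y \<and> v \<sim> z"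
          using tri v by (auto simp: dominating_triangle_def priv_def)
        then show ?thesis
        proof cases
          case 1
          then have "v \<sim> x" "v \<sim> p \<or> v \<sim> q"
            using priv_cover[OF p(1) q(1) pq(7) 1] by (auto simp: priv_def)
          then show ?thesis using dist by (auto simp: S_def)
        next
          case 2
          then have "v \<sim> y" "v \<sim> q"
            using q(2) edge_sym by (auto simp: priv_def)
          then show ?thesis using dist by (auto simp: S_def)
        next
          case 3
          then have "v \<sim> z" "v \<sim> p"
            using p(2) edge_sym by (auto simp: priv_def)
          then show ?thesis using dist by (auto simp: S_def)
        next
          case 4
          then show ?thesis using dist by (auto simp: S_def)
        qed
      qed
      then show ?thesis
        using False two_le_card_nb_Int by auto
    qed
  qed
  also have "\<dots> \<le> 5 * D"
    using sum_card_nb_Int_le[OF \<open>S \<subseteq> V\<close>] \<open>card S = 5\<close> by simp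
  finally show ?thesis .
qed

text \<open>If some vertex of \<open>priv x y z\<close> misses all of \<open>priv y x z\<close>, then \<open>priv_cover\<close> gives
  every vertex of \<open>priv z x y\<close> a neighbour in \<open>priv x y z\<close>.  Hence some pair of private sets
  sees each other completely.\<close>

lemma dominating_triangle_num_edges:
  assumes tri: "dominating_triangle x y z" and "2 \<le> D"
  shows "4 * num_edges V m + 2 * D \<le> 5 * D\<^sup>2"
proof -
  have from_card: ?thesis if "2 * card V + 2 \<le> 5 * D"
  proof -
    have "D * (2 * card V + 2) \<le> D * (5 * D)"
      using that by (rule mult_le_mono2)
    with num_edges_le_card show ?thesis
      by (simp add: power2_eq_square algebra_simps)
  qed
  define A where "A a b c = priv a b c" for a b c
  have swap: "A a b c = A a c b" for a b c
    by (simp add: A_def priv_swap)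
  define E where "E P Q \<longleftrightarrow> (\<exists>u\<in>P. \<exists>v\<in>Q. u \<sim> v)" for P Q :: "'a set"
  define H where "H P Q \<longleftrightarrow> (\<forall>u\<in>P. \<exists>v\<in>Q. u \<sim> v)" for P Q :: "'a set"
  let ?A = "A x y z" and ?B = "A y z x" and ?C = "A z x y"
  have E_sym: "E P Q \<longleftrightarrow> E Q P" for P Q
    unfolding E_def using edge_sym by blast
  have cover: "w \<sim> u \<or> w \<sim> v"
    if "u \<in> A b c a" "v \<in> A c a b" "u \<sim> v" "w \<in> A a b c" for a b c u v w
    using priv_cover[of u b a c v w] that by (simp add: A_def priv_swap)
  show ?thesis
  proof (cases "?A = {} \<or> ?B = {} \<or> ?C = {}")
    case True
    then have "card V \<le> 2 * D"
      using priv_empty_card_le[OF tri]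
        priv_empty_card_le[OF dominating_triangle_rotate[OF tri]]
        priv_empty_card_le[OF dominating_triangle_rotate[OF dominating_triangle_rotate[OF tri]]]
      by (auto simp: A_def priv_swap)
    then show ?thesis
      using \<open>2 \<le> D\<close> by (intro from_card) linarith
  next
    case False
    \<comment> \<open>Star pattern with centre \<open>A a b c\<close>. By \<open>cover\<close>, a
      vertex of an outer set sees an end of any edge between the centre and the other outer set, and
      this must be the end in the centre.\<close>
    have two: "2 * card V + 2 \<le> 5 * D"
      if t: "dominating_triangle a b c" and ne: "A a b c \<noteq> {}"
        and n: "\<not> E (A b c a) (A c a b)" and e: "E (A a b c) (A b c a)" "E (A a b c) (A c a b)"
      for a b c
    proof (rule priv_star_card_le[OF t])
      show "priv a b c \<noteq> {}"
        using ne by (simp add: A_def)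
      show "\<not> u \<sim> v" if "u \<in> priv b a c" "v \<in> priv c a b" for u v
        using n that by (auto simp: E_def A_def priv_swap)
      obtain r s where rs: "r \<in> A a b c" "s \<in> A b c a" "r \<sim> s"
        using e by (auto simp: E_def)
      obtain r' s' where rs': "r' \<in> A a b c" "s' \<in> A c a b" "r' \<sim> s'"
        using e by (auto simp: E_def)
      show "\<exists>u\<in>priv a b c. v \<sim> u" if v: "v \<in> priv b a c \<union> priv c a b" for v
      proof (cases "v \<in> A b c a")
        case True
        then have "v \<sim> r'"
          using cover[OF rs'(2,1) _ True] rs'(2,3) edge_sym n by (auto simp: E_def)
        with rs' show ?thesis by (auto simp: A_def)
      next
        case False
        then have C: "v \<in> A c a b"
          using v by (simp add: A_def priv_swap)
        then have "v \<sim> r"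
          using cover[OF rs(1,2,3) C] rs(2) edge_sym n by (auto simp: E_def)
        with rs show ?thesis by (auto simp: A_def)
      qed
    qed
    have mutual: "2 * card V + 2 \<le> 5 * D"
      if t: "dominating_triangle a b c" and ne: "A b c a \<noteq> {}" "A c a b \<noteq> {}"
        and H: "H (A b c a) (A c a b)" "H (A c a b) (A b c a)" for a b c
      using priv_mutual_card_le[OF t] ne H by (simp add: A_def H_def priv_swap)
    have flag: "H (A c a b) (A a b c)"
      if nH: "\<not> H (A a b c) (A b c a)" and e: "E (A a b c) (A b c a)" for a b c
      unfolding H_def
    proof
      fix r assume r: "r \<in> A c a b"
      obtain w where w: "w \<in> A a b c" "\<And>v. v \<in> A b c a \<Longrightarrow> \<not> w \<sim> v"
        using nH by (auto simp: H_def)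
      obtain u v where uv: "u \<in> A a b c" "v \<in> A b c a" "u \<sim> v"
        using e by (auto simp: E_def)
      show "\<exists>u\<in>A a b c. r \<sim> u"
      proof (cases "r \<sim> u")
        case False
        then have "v \<sim> r"
          using cover[OF uv r] edge_sym by blast
        then have "w \<sim> r"
          using cover[OF uv(2) r _ w(1)] w(2)[OF uv(2)] by blast
        with w show ?thesis using edge_sym by blast
      qed (use uv in blast)
    qed
    have flag': "H (A c a b) (A b c a)"
      if "\<not> H (A b c a) (A a b c)" "E (A a b c) (A b c a)" for a b c
      using flag[of b a c] that E_sym by (simp add: swap)
    note tri2 = dominating_triangle_rotate[OF tri]
    note tri3 = dominating_triangle_rotate[OF tri2]
    \<comment> \<open>The split is by the number of pairs of private sets joined by an edge. None:
      they are independent. One: impossible, as by \<open>cover\<close> a vertex of the third set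
      sees an end of that edge. Two: a star. Three: some pair is mutual.\<close>
    consider "\<not> E ?A ?B" "\<not> E ?B ?C" "\<not> E ?C ?A"
      | "E ?A ?B" "\<not> E ?B ?C" "\<not> E ?C ?A" | "\<not> E ?A ?B" "E ?B ?C" "\<not> E ?C ?A"
      | "\<not> E ?A ?B" "\<not> E ?B ?C" "E ?C ?A"
      | "\<not> E ?A ?B" "E ?B ?C" "E ?C ?A" | "E ?A ?B" "\<not> E ?B ?C" "E ?C ?A"
      | "E ?A ?B" "E ?B ?C" "\<not> E ?C ?A"
      | "E ?A ?B" "E ?B ?C" "E ?C ?A"
      by blast
    then show ?thesis
    proof cases
      case 1
      have st: "\<not> u \<sim> v" if "u \<in> P" "v \<in> P" "P = ?A \<or> P = ?B \<or> P = ?C" for u v P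
        using that priv_stable[of y z u x v] priv_stable[of z x u y v] priv_stable[of x y u z v] tri
          edge_sym by (auto simp: A_def dominating_triangle_def)
      have "\<not> u \<sim> v" if "u \<in> ?A \<union> ?B \<union> ?C" "v \<in> ?A \<union> ?B \<union> ?C" for u v
        using that 1 st[of u _ v] edge_sym[of u v] unfolding E_def by blast
      then show ?thesis
        by (intro priv_independent_num_edges[OF tri \<open>2 \<le> D\<close>]) (simp add: A_def priv_swap)
    next
      case 2
      then show ?thesis using False cover[where a=z and b=x and c=y] E_sym[of ?B ?C] unfolding E_def by blast
    next
      case 3
      then show ?thesis using False cover[where a=x and b=y and c=z] E_sym[of ?C ?A] unfolding E_def by blast
    next
      case 4
      then show ?thesis using False cover[where a=y and b=z and c=x] E_sym[of ?A ?B] unfolding E_def by blast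
    next
      case 5
      then show ?thesis using False two[OF tri3] from_card E_sym by blast
    next
      case 6
      then show ?thesis using False two[OF tri] from_card E_sym by blast
    next
      case 7
      then show ?thesis using False two[OF tri2] from_card E_sym by blast
    next
      case 8
      \<comment> \<open>By \<open>flag\<close>, at most one of \<open>H ?A ?B\<close>,
        \<open>H ?B ?C\<close>, \<open>H ?C ?A\<close> fails; by \<open>flag'\<close>, the same
        holds for the reversed relations. So at most two of the three pairs are spoiled.\<close>
      have "H ?B ?C \<and> H ?C ?B \<or> H ?C ?A \<and> H ?A ?C \<or> H ?A ?B \<and> H ?B ?A"
        using flag[of x y z] flag[of y z x] flag[of z x y]
          flag'[of x y z] flag'[of y z x] flag'[of z x y] 8 by blast
      then show ?thesis
        using False mutual[OF tri] mutual[OF tri2] mutual[OF tri3] from_card by blast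
    qed
  qed
qed

subsection \<open>Dominating cliques\<close>

lemma clique_edge: "is_clique V m K \<Longrightarrow> a \<in> K \<Longrightarrow> b \<in> K \<Longrightarrow> a \<noteq> b \<Longrightarrow> a \<sim> b"
  by (simp add: is_clique_def)

lemma clique_subset_V: "is_clique V m K \<Longrightarrow> K \<subseteq> V"
  by (simp add: is_clique_def)

lemma finite_clique: "is_clique V m K \<Longrightarrow> finite K"
  using clique_subset_V finite_subset finite_V by blast

lemma clique_meets_edge:
  assumes "is_clique V m K" "a \<in> K" "b \<in> K" "a \<noteq> b" "u \<sim> v"
  shows "u \<sim> a \<or> u \<sim> b \<or> v \<sim> a \<or> v \<sim> b"
  using no_2K2[OF \<open>u \<sim> v\<close> clique_edge[OF assms(1-4)]] by blast

text \<open>Two clique vertices missed by both \<open>u\<close> and \<open>v\<close> would form an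
  induced 2K2 with \<open>u v\<close>, so at most one is missed.\<close>

lemma card_clique_le_nb:
  assumes cl: "is_clique V m K" and uv: "u \<sim> v"
  shows "card K \<le> card (nb u \<inter> K) + card (nb v \<inter> K) + 1"
proof -
  let ?M = "K - (nb u \<union> nb v)"
  note fin = finite_clique[OF cl]
  have "a = b" if "a \<in> ?M" "b \<in> ?M" for a b
    using clique_meets_edge[OF cl _ _ _ uv, of a b] that by auto
  then have "card ?M \<le> Suc 0"
    using fin by (simp add: card_le_Suc0_iff_eq)
  moreover have "card K = card ?M + card (K \<inter> (nb u \<union> nb v))"
    using card_Int_Diff[OF fin, of "nb u \<union> nb v"] by simp
  moreover have "card (K \<inter> (nb u \<union> nb v)) \<le> card (nb u \<inter> K) + card (nb v \<inter> K)"
    by (simp add: Int_Un_distrib Int_commute card_Un_le)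
  ultimately show ?thesis by linarith
qed

lemma finite_cliques: "finite {card S |S. is_clique V m S}"
proof (rule finite_subset)
  show "{card S |S. is_clique V m S} \<subseteq> card ` Pow V"
    using clique_subset_V by auto
qed simp

lemma card_clique_le: "is_clique V m S \<Longrightarrow> card S \<le> clique_number V m"
  unfolding clique_number_def by (intro Max_ge finite_cliques) auto

lemma maximum_clique: "\<exists>S. is_clique V m S \<and> card S = clique_number V m"
proof -
  have "is_clique V m {}"
    by (simp add: is_clique_def)
  then have "clique_number V m \<in> {card S |S. is_clique V m S}"
    unfolding clique_number_def by (intro Max_in finite_cliques) auto
  then show ?thesis by auto
qed

text \<open>Total domination: a member of \<open>K\<close> also needs a neighbour in
  \<open>K\<close>, so a dominating clique has a positive neighbour count at every vertex.\<close>

definition dominates :: "'a set \<Rightarrow> 'a \<Rightarrow> bool" where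
  "dominates K v \<longleftrightarrow> nb v \<inter> K \<noteq> {}"

text \<open>Among the maximum cliques, one with the fewest undominated vertices dominates everything:
  an undominated vertex \<open>z\<close> has a dominated neighbour \<open>y\<close>, which misses exactly one clique
  vertex and can replace it.\<close>

lemma exists_dominating_clique:
  assumes "3 \<le> clique_number V m"
  shows "\<exists>K. is_clique V m K \<and> 3 \<le> card K \<and> (\<forall>v\<in>V. dominates K v)"
proof -
  define P where "P K \<longleftrightarrow> is_clique V m K \<and> card K = clique_number V m" for K
  define Z where "Z K = {v \<in> V. \<not> dominates K v}" for K
  obtain K where K: "P K" and min: "\<And>K'. P K' \<Longrightarrow> card (Z K) \<le> card (Z K')"
    using ex_has_least_nat[of P _ "\<lambda>K. card (Z K)"] maximum_clique unfolding P_def by blast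
  have cl: "is_clique V m K" and cK: "card K = clique_number V m" "3 \<le> card K"
    using K assms by (auto simp: P_def)
  note fin = finite_clique[OF cl]
  have ne_other: "\<exists>b\<in>K. b \<notin> {a, a'}" for a a'
  proof (rule ccontr)
    assume "\<not> ?thesis"
    then have "card K \<le> card {a, a'}" by (intro card_mono) auto
    then show False using cK card_insert_le_m1[of 2 "{a'}" a] by simp
  qed
  have "Z K = {}"
  proof (rule ccontr)
    assume "Z K \<noteq> {}"
    then obtain z0 where z0: "z0 \<in> Z K" by blast
    obtain k where k: "k \<in> K" using ne_other by blast
    obtain k' where k': "k' \<in> K" "k' \<notin> {k, k}" using ne_other by blast
    have "k \<in> V - Z K"
      using clique_edge[OF cl k k'(1)] k' k clique_subset_V[OF cl] by (auto simp: Z_def dominates_def)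
    then obtain y z where y: "y \<in> V" "y \<notin> Z K" and z: "z \<in> Z K" "y \<sim> z"
      using edge_leaving[of "V - Z K" k z0] z0 by (auto simp: Z_def)
    have zK: "\<not> z \<sim> x" if "x \<in> K" for x
      using z that by (auto simp: Z_def dominates_def)
    have yK: "y \<notin> K"
      using zK z edge_sym by blast
    have miss: "y \<sim> a \<or> y \<sim> b" if "a \<in> K" "b \<in> K" "a \<noteq> b" for a b
      using clique_meets_edge[OF cl that z(2)] zK that by blast
    have "\<exists>x0\<in>K. \<not> y \<sim> x0"
    proof (rule ccontr)
      assume "\<not> ?thesis"
      then have "is_clique V m (insert y K)"
        using cl y(1) edge_sym by (auto simp: is_clique_def)
      then have "card (insert y K) \<le> card K"
        using card_clique_le cK by metis
      then show False using yK fin by simp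
    qed
    then obtain x0 where x0: "x0 \<in> K" "\<not> y \<sim> x0" by blast
    define K' where "K' = insert y (K - {x0})"
    have "is_clique V m K'"
      using cl y(1) miss[OF _ x0(1)] x0(2) edge_sym by (auto simp: is_clique_def K'_def)
    moreover have "card K' = card K"
      using yK x0(1) fin cK(2) by (simp add: K'_def)
    ultimately have "P K'" using K by (simp add: P_def)
    \<comment> \<open>Suppose \<open>w\<close> becomes undominated. Its only neighbour in
      \<open>K\<close> was \<open>x0\<close>, and comparing \<open>w x0\<close> with
      \<open>y z\<close> makes \<open>w\<close> and \<open>z\<close> adjacent. The edge
      \<open>w z\<close> then misses two further vertices of \<open>K\<close>, which exist because
      \<open>card K\<close> is at least 3.\<close>
    moreover have "Z K' \<subset> Z K"
    proof
      show "Z K' \<subseteq> Z K"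
      proof
        fix w assume w: "w \<in> Z K'"
        show "w \<in> Z K"
        proof (rule ccontr)
          assume "w \<notin> Z K"
          then obtain x where x: "x \<in> K" "w \<sim> x"
            using w by (auto simp: Z_def dominates_def)
          have n: "\<not> w \<sim> a" if "a \<in> K'" for a
            using w that by (auto simp: Z_def dominates_def)
          have "x = x0" using n[of x] x by (auto simp: K'_def)
          then have "w \<sim> z"
            using no_2K2[of w x y z] x z(2) x0 zK n[of y] edge_sym by (auto simp: K'_def)
          obtain a where a: "a \<in> K" "a \<notin> {x0, x0}" using ne_other by blast
          obtain b where b: "b \<in> K" "b \<notin> {x0, a}" using ne_other by blast
          show False
            using clique_meets_edge[OF cl a(1) b(1) _ \<open>w \<sim> z\<close>] a b n[of a] n[of b] zK
            by (auto simp: K'_def)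
        qed
      qed
      have "z \<notin> Z K'"
        using z(2) edge_sym[of y z] by (auto simp: Z_def dominates_def K'_def)
      then show "Z K' \<noteq> Z K" using z by blast
    qed
    then have "card (Z K') < card (Z K)"
      by (intro psubset_card_mono) (simp_all add: Z_def)
    ultimately show False using min[of K'] by simp
  qed
  then show ?thesis using cl cK by (auto simp: Z_def)
qed

text \<open>Adjacent vertices have counts summing to at least 4. Members of \<open>K\<close> have
  count 4, but their neighbours all see some vertex of \<open>K\<close>, so weight 3 is enough on
  \<open>K\<close>; this saves 5 in the total.\<close>

lemma five_clique_num_edges:
  assumes cl: "is_clique V m K" and K: "card K = 5"
  shows "4 * num_edges V m + 5 * D \<le> 5 * D\<^sup>2"
proof -
  note KV = clique_subset_V[OF cl] and fin = finite_clique[OF cl]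
  have inK: "card (nb x \<inter> K) = 4" if "x \<in> K" for x
  proof -
    have "nb x \<inter> K = K - {x}"
      using clique_edge[OF cl that] by auto
    then show ?thesis using K that fin by simp
  qed
  define g where "g v = (if v \<in> K then 3 else card (nb v \<inter> K))" for v
  have "4 \<le> g u + g v" if uv: "u \<sim> v" for u v
  proof -
    have pos: "1 \<le> card (nb a \<inter> K)" if "a \<sim> b" "b \<in> K" for a b
      using that fin card_0_eq[of "nb a \<inter> K"] by (auto simp: Suc_le_eq card_gt_0_iff)
    have "4 \<le> card (nb u \<inter> K) + card (nb v \<inter> K)"
      using card_clique_le_nb[OF cl uv] K by linarith
    moreover have "1 \<le> card (nb v \<inter> K)" if "u \<in> K"
      using pos[of v u] uv that edge_sym by blast
    moreover have "1 \<le> card (nb u \<inter> K)" if "v \<in> K"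
      using pos[of u v] uv that by blast
    ultimately show ?thesis by (auto simp: g_def)
  qed
  then have "4 * num_edges V m \<le> D * (\<Sum>v\<in>V. g v)"
    by (rule num_edges_le_cover)
  moreover have "(\<Sum>v\<in>V. g v) + 5 = (\<Sum>v\<in>V. g v + of_bool (v \<in> K))"
    unfolding sum.distrib using KV K by (simp add: Int_absorb1)
  moreover have "(\<Sum>v\<in>V. g v + of_bool (v \<in> K)) = (\<Sum>v\<in>V. card (nb v \<inter> K))"
    by (intro sum.cong refl) (simp add: g_def inK)
  moreover have "\<dots> \<le> 5 * D"
    using sum_card_nb_Int_le[OF KV] K by simp
  ultimately have "4 * num_edges V m \<le> D * (\<Sum>v\<in>V. g v)" "(\<Sum>v\<in>V. g v) + 5 \<le> 5 * D"
    by simp_all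
  moreover have "D * ((\<Sum>v\<in>V. g v) + 5) \<le> D * (5 * D)"
    using calculation(2) by (rule mult_le_mono2)
  ultimately show ?thesis
    by (simp add: power2_eq_square algebra_simps)
qed

text \<open>A vertex \<open>u\<close> adjacent to exactly \<open>x3\<close> and \<open>x4\<close> and to a private neighbour of \<open>x1\<close>
  sees everything that only \<open>x1\<close> or \<open>x2\<close> dominates, so it can replace these two.\<close>

lemma four_clique_dominating_triangle:
  assumes cl: "is_clique V m K" and K: "card K = 4" and dom: "\<forall>v\<in>V. dominates K v"
    and priv: "\<And>x. x \<in> K \<Longrightarrow> \<exists>b\<in>V. nb b \<inter> K = {x}"
    and u: "card (nb u \<inter> K) = 2" and b: "card (nb b \<inter> K) = 1" and ub: "u \<sim> b"
  shows "\<exists>x y z. dominating_triangle x y z"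
proof -
  note fin = finite_clique[OF cl]
  obtain x3 x4 where x34: "nb u \<inter> K = {x3, x4}" "x3 \<noteq> x4"
    using u by (auto simp: card_2_iff)
  obtain x1 where x1: "nb b \<inter> K = {x1}"
    using b by (auto simp: card_1_singleton_iff)
  have in34: "x \<in> nb u \<inter> K \<longleftrightarrow> x = x3 \<or> x = x4" for x
    unfolding x34(1) by simp
  have x34K: "x3 \<in> K" "x4 \<in> K" "u \<sim> x3" "u \<sim> x4"
    using in34[of x3] in34[of x4] by simp_all
  have uK: "\<not> u \<sim> x" if "x \<in> K" "x \<noteq> x3" "x \<noteq> x4" for x
    using in34[of x] that by simp
  have "card (K - {x3, x4}) = 2"
    using K x34K x34(2) fin by (simp add: card_Diff_subset)
  then obtain a a' where aa: "K - {x3, x4} = {a, a'}" "a \<noteq> a'"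
    by (auto simp: card_2_iff)
  have aK: "a \<in> K" "a' \<in> K" "a \<notin> {x3, x4}" "a' \<notin> {x3, x4}"
    using aa by blast+
  have "b \<sim> a \<or> b \<sim> a'"
    using clique_meets_edge[OF cl aK(1,2) aa(2) ub] uK aK by auto
  then have "a \<in> nb b \<inter> K \<or> a' \<in> nb b \<inter> K"
    using aK by simp
  then have x1a: "x1 = a \<or> x1 = a'"
    unfolding x1 by blast
  obtain x2 where x2: "K = {x1, x2, x3, x4}" "distinct [x1, x2, x3, x4]"
  proof -
    have "K = {a, a', x3, x4}"
      using aa(1) x34K by blast
    moreover have "distinct [a, a', x3, x4]"
      using aa(2) aK x34(2) by simp
    ultimately show thesis
      using x1a that[of a'] that[of a] insert_commute[of a a'] by (elim disjE) auto
  qed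
  have xK: "x1 \<in> K" "x2 \<in> K"
    by (simp_all add: x2(1))
  have only: "\<not> v \<sim> y" if "nb v \<inter> K = {x}" "y \<in> K" "y \<noteq> x" for v x y
  proof
    assume "v \<sim> y"
    then have "y \<in> nb v \<inter> K" using that(2) by simp
    then show False unfolding that(1) using that(3) by simp
  qed
  have only1: "\<not> v \<sim> x2 \<and> \<not> v \<sim> x3 \<and> \<not> v \<sim> x4" if "nb v \<inter> K = {x1}" for v
    using only[OF that] x2(2) xK x34K by auto
  have only2: "\<not> v \<sim> x1 \<and> \<not> v \<sim> x3 \<and> \<not> v \<sim> x4" if "nb v \<inter> K = {x2}" for v
    using only[OF that] x2(2) xK x34K by auto
  have e: "x1 \<sim> x2" "x3 \<sim> x4" "x1 \<sim> x3" "x1 \<sim> x4" "x2 \<sim> x3" "x2 \<sim> x4"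
    using clique_edge[OF cl] x2(2) xK x34K by simp_all
  have nu: "\<not> u \<sim> x1" "\<not> u \<sim> x2" "\<not> x1 \<sim> u" "\<not> x2 \<sim> u"
    using uK[of x1] uK[of x2] x2(2) xK edge_sym[of u] by simp_all
  have away34: "\<not> v \<sim> w"
    if "\<not> v \<sim> x3" "\<not> v \<sim> x4" "\<not> w \<sim> x3" "\<not> w \<sim> x4" for v w
    using no_2K2[OF _ e(2), of v w] that by blast
  \<comment> \<open>Compare \<open>u b\<close> with \<open>v x2\<close>. Neither \<open>u\<close>
    nor \<open>b\<close> sees \<open>x2\<close>, and \<open>b\<close>, \<open>v\<close> both miss
    the edge \<open>x3 x4\<close>, so they are not adjacent.\<close>
  have ub2: "u \<sim> v" if "nb v \<inter> K = {x2}" for v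
  proof -
    have "x2 \<in> nb v \<inter> K" using that by simp
    then have "v \<sim> x2" by simp
    then show ?thesis
      using no_2K2[OF ub, of v x2] only1[OF x1] only2[OF that] away34[of b v] nu by blast
  qed
  obtain b2 where b2: "nb b2 \<inter> K = {x2}"
    using priv[OF xK(2)] by blast
  \<comment> \<open>With \<open>u b2\<close> in place of \<open>u b\<close> the same comparison
    reaches every such \<open>v\<close>, even one that also sees \<open>x2\<close>.\<close>
  have far: "u \<sim> v" if v: "v \<sim> x1" "\<not> v \<sim> x3" "\<not> v \<sim> x4" for v
    using no_2K2[OF v(1) ub2[OF b2]] nu only2[OF b2] away34[of v b2] v edge_sym by blast
  have "dominating_triangle u x3 x4"
    unfolding dominating_triangle_def
  proof (intro conjI ballI)
    fix v assume v: "v \<in> V"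
    show "v \<sim> u \<or> v \<sim> x3 \<or> v \<sim> x4"
    proof (cases "v \<sim> x1 \<or> v \<sim> x3 \<or> v \<sim> x4")
      case True
      then show ?thesis using far edge_sym by blast
    next
      case False
      then have "nb v \<inter> K = {x2}"
        using dom v x2 by (auto simp: dominates_def)
      then show ?thesis using ub2 edge_sym by blast
    qed
  qed (use x34K e in auto)
  then show ?thesis by blast
qed

text \<open>Counts of adjacent vertices sum to at least 3, and the sum 3 means the counts 1 and 2,
  which yield a dominating triangle. Hence the counts minus one sum to at least 2 on each edge, with
  total at most \<open>4 * D - card V\<close>. Adding the plain vertex bound cancels
  \<open>card V\<close>.\<close>

lemma four_clique_num_edges:
  assumes cl: "is_clique V m K" and K: "card K = 4" and dom: "\<forall>v\<in>V. dominates K v"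
    and priv: "\<And>x. x \<in> K \<Longrightarrow> \<exists>b\<in>V. nb b \<inter> K = {x}"
    and notri: "\<not> (\<exists>x y z. dominating_triangle x y z)"
  shows "num_edges V m \<le> D\<^sup>2"
proof -
  define t where "t v = card (nb v \<inter> K)" for v
  have t_pos: "1 \<le> t v" if "v \<in> V" for v
    using dom that by (auto simp: t_def dominates_def Suc_le_eq card_gt_0_iff)
  have "2 \<le> (t u - 1) + (t v - 1)" if uv: "u \<sim> v" for u v
  proof -
    have "3 \<le> t u + t v"
      using card_clique_le_nb[OF cl uv] K by (simp add: t_def)
    moreover have "\<not> (t u = 2 \<and> t v = 1)" "\<not> (t u = 1 \<and> t v = 2)"
      using four_clique_dominating_triangle[OF cl K dom priv] notri uv edge_sym unfolding t_def by blast+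
    moreover have "1 \<le> t u" "1 \<le> t v"
      using t_pos edge_in_V[OF uv] by auto
    ultimately show ?thesis by linarith
  qed
  then have "2 * num_edges V m \<le> D * (\<Sum>v\<in>V. t v - 1)"
    by (rule num_edges_le_cover)
  moreover have "(\<Sum>v\<in>V. t v - 1) + card V = (\<Sum>v\<in>V. t v - 1 + 1)"
    by (simp only: sum.distrib card_eq_sum)
  moreover have "(\<Sum>v\<in>V. t v - 1 + 1) = (\<Sum>v\<in>V. t v)"
    by (intro sum.cong refl le_add_diff_inverse2 t_pos)
  moreover have "\<dots> \<le> 4 * D"
    using sum_card_nb_Int_le[OF clique_subset_V[OF cl]] K by (simp add: t_def)
  ultimately have "2 * num_edges V m \<le> D * (\<Sum>v\<in>V. t v - 1)"
    "(\<Sum>v\<in>V. t v - 1) + card V \<le> 4 * D"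
    by simp_all
  moreover have "D * ((\<Sum>v\<in>V. t v - 1) + card V) \<le> D * (4 * D)"
    using calculation(2) by (rule mult_le_mono2)
  ultimately show ?thesis
    using num_edges_le_card by (simp add: power2_eq_square algebra_simps)
qed

theorem large_clique_num_edges:
  assumes "2 \<le> D" "3 \<le> clique_number V m"
  shows "4 * num_edges V m + 2 * D \<le> 5 * D\<^sup>2"
proof (cases "\<exists>x y z. dominating_triangle x y z")
  case True
  then show ?thesis using dominating_triangle_num_edges[OF _ assms(1)] by blast
next
  case False
  define P where "P K \<longleftrightarrow> is_clique V m K \<and> 3 \<le> card K \<and> (\<forall>v\<in>V. dominates K v)" for K
  \<comment> \<open>Minimality supplies private neighbours: if \<open>card K = 4\<close> and
    \<open>x\<close> had none, \<open>K - {x}\<close> would still dominate and have the admissible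
    size 3. From size 5 on, any five clique vertices do, dominating or not.\<close>
  obtain K where K: "P K" and min: "\<And>K'. P K' \<Longrightarrow> card K \<le> card K'"
    using ex_has_least_nat[of P _ card] exists_dominating_clique[OF assms(2)] unfolding P_def by blast
  have cl: "is_clique V m K" and dom: "\<forall>v\<in>V. dominates K v"
    using K by (auto simp: P_def)
  note fin = finite_clique[OF cl]
  have "card K \<noteq> 3"
  proof
    assume "card K = 3"
    then obtain x y z where "K = {x, y, z}" "x \<noteq> y" "x \<noteq> z" "y \<noteq> z"
      by (auto simp: card_3_iff)
    then have "dominating_triangle x y z"
      using clique_edge[OF cl] dom unfolding dominating_triangle_def dominates_def by auto
    with False show False by blast
  qed
  with K have "4 \<le> card K" by (auto simp: P_def)
  then consider "card K = 4" | "5 \<le> card K" by linarith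
  then show ?thesis
  proof cases
    case 1
    have "\<exists>b\<in>V. nb b \<inter> K = {x}" if "x \<in> K" for x
    proof (rule ccontr)
      assume neg: "\<not> ?thesis"
      have "dominates (K - {x}) v" if "v \<in> V" for v
        using neg that dom unfolding dominates_def by blast
      then have "P (K - {x})"
        using cl 1 \<open>x \<in> K\<close> fin by (auto simp: P_def is_clique_def)
      then show False
        using min[of "K - {x}"] 1 \<open>x \<in> K\<close> fin by simp
    qed
    then have "num_edges V m \<le> D\<^sup>2"
      by (intro four_clique_num_edges[OF cl 1 dom _ False])
    moreover have "2 * D \<le> D * D"
      using assms(1) by (rule mult_le_mono1)
    ultimately show ?thesis
      unfolding power2_eq_square by linarith
  next
    case 2
    then obtain S where S: "S \<subseteq> K" "card S = 5"
      by (rule obtain_subset_with_card_n)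
    have "is_clique V m S"
      using cl S(1) by (auto simp: is_clique_def)
    from five_clique_num_edges[OF this S(2)] show ?thesis
      by linarith
  qed
qed

subsection \<open>Triangle-free graphs that are not bipartite\<close>

definition triangle_free :: bool where
  "triangle_free \<longleftrightarrow> (\<forall>a b c. a \<sim> b \<longrightarrow> b \<sim> c \<longrightarrow> \<not> a \<sim> c)"

text \<open>A pentagon is a closed walk of length five, indexed modulo 5; in a triangle-free graph it is
  an induced five-cycle.\<close>

definition pentagon :: "(nat \<Rightarrow> 'a) \<Rightarrow> bool" where
  "pentagon p \<longleftrightarrow> (\<forall>i. p i = p (i mod 5) \<and> p i \<sim> p (i + 1))"

text \<open>For an edge \<open>uv\<close> the remaining vertices outside \<open>nb u \<union> nb v\<close> are stable; they can
  be distributed over the two sides unless one of them has neighbours in both \<open>nb u\<close> and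
  \<open>nb v\<close>.\<close>

lemma exists_pentagon:
  assumes tf: triangle_free and nb: "\<not> bipartite_mg V m"
  shows "\<exists>p. pentagon p"
proof -
  have tri: "\<not> a \<sim> c" if "a \<sim> b" "b \<sim> c" for a b c
    using tf that by (auto simp: triangle_free_def)
  obtain u v where uv: "u \<sim> v"
    using nb by (auto simp: bipartite_mg_def)
  define N where "N x \<longleftrightarrow> (\<exists>a. x \<sim> a \<and> v \<sim> a)" for x
  \<comment> \<open>The candidate side: a vertex outside both neighbourhoods joins the neighbours of
    \<open>v\<close> unless it is adjacent to one of them.\<close>
  define S where "S = {x \<in> V. v \<sim> x \<or> \<not> u \<sim> x \<and> \<not> N x}"
  have far: "\<not> x \<sim> y" if "\<not> u \<sim> x" "\<not> u \<sim> y" "\<not> v \<sim> x" "\<not> v \<sim> y" for x y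
    using no_2K2[OF uv, of x y] that by blast
  have "\<exists>z a b. z \<sim> a \<and> v \<sim> a \<and> z \<sim> b \<and> u \<sim> b"
  proof (rule ccontr)
    assume none: "\<not> ?thesis"
    have "\<not> (x \<in> S \<and> y \<in> S)" if xy: "x \<sim> y" for x y
    proof
      assume S: "x \<in> S \<and> y \<in> S"
      consider "v \<sim> x" "v \<sim> y" | "v \<sim> x" "\<not> v \<sim> y" | "\<not> v \<sim> x" "v \<sim> y"
        | "\<not> v \<sim> x" "\<not> v \<sim> y" by blast
      then show False
      proof cases
        case 1
        then show False using tri xy by blast
      next
        case 2
        then have "\<not> N y" using S by (simp add: S_def)
        then show False using 2 xy edge_sym by (auto simp: N_def)
      next
        case 3
        then have "\<not> N x" using S by (simp add: S_def)
        then show False using 3 xy by (auto simp: N_def)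
      next
        case 4
        then show False using S far[of x y] xy by (simp add: S_def)
      qed
    qed
    moreover have "x \<in> S \<or> y \<in> S" if xy: "x \<sim> y" for x y
    proof (rule ccontr)
      assume S: "\<not> ?thesis"
      have V: "x \<in> V" "y \<in> V" using edge_in_V[OF xy] by auto
      have out: "\<not> v \<sim> x" "\<not> v \<sim> y" "u \<sim> x \<or> N x" "u \<sim> y \<or> N y"
        using S V by (auto simp: S_def)
      consider "u \<sim> x" "u \<sim> y" | "u \<sim> x" "N y" | "u \<sim> y" "N x" | "\<not> u \<sim> x" "\<not> u \<sim> y"
        using out by blast
      then show False
      proof cases
        case 1
        then show False using tri xy by blast
      next
        case 2
        then show False using none xy edge_sym[of x y] by (auto simp: N_def)
      next
        case 3
        then show False using none xy by (auto simp: N_def)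
      next
        case 4
        then show False using far[of x y] out xy by blast
      qed
    qed
    ultimately have "bipartite_mg V m"
      unfolding bipartite_mg_def by (intro exI[of _ S]) (auto simp: S_def)
    with nb show False by blast
  qed
  then obtain z a b where zab: "z \<sim> a" "v \<sim> a" "z \<sim> b" "u \<sim> b" by blast
  define p where "p i = [u, v, a, z, b] ! (i mod 5)" for i
  have "p i \<sim> p (i + 1)" for i
  proof -
    have "i mod 5 = 0 \<or> i mod 5 = 1 \<or> i mod 5 = 2 \<or> i mod 5 = 3 \<or> i mod 5 = 4"
      by presburger
    then show ?thesis
      using uv zab edge_sym by (auto simp: p_def mod_Suc)
  qed
  then have "pentagon p"
    by (simp add: pentagon_def p_def)
  then show ?thesis by blast
qed

text \<open>The vertices that can stand in for \<open>p i\<close> in the pentagon;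
  \<open>i + 4\<close> is the predecessor of \<open>i\<close> modulo 5.\<close>

definition pclass :: "(nat \<Rightarrow> 'a) \<Rightarrow> nat \<Rightarrow> 'a set" where
  "pclass p i = {v \<in> V. v \<sim> p (i + 1) \<and> v \<sim> p (i + 4)}"

text \<open>Every class is inhabited because the degree bound on two classes is read off from a
  vertex of the class between them.\<close>

definition pentagonal :: "('a \<Rightarrow> nat) \<Rightarrow> bool" where
  "pentagonal h \<longleftrightarrow> (\<forall>v\<in>V. h v < 5) \<and> (\<forall>i<5. \<exists>v\<in>V. h v = i) \<and>
     (\<forall>u\<in>V. \<forall>v\<in>V. u \<sim> v \<longleftrightarrow> consecutive (h u) (h v))"

section \<open>The blow-up structure over a pentagon\<close>

lemma less_five: "i < 5 \<longleftrightarrow> i = 0 \<or> i = 1 \<or> i = 2 \<or> i = 3 \<or> i = (4::nat)"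
  by linarith

lemma five_cases:
  assumes "i < 5" "j < (5::nat)"
  shows "j = i \<or> j = (i + 1) mod 5 \<or> i = (j + 1) mod 5 \<or> j = (i + 2) mod 5 \<or> i = (j + 2) mod 5"
  using assms unfolding less_five by (elim disjE) simp_all

text \<open>A neighbour of \<open>p j\<close> must see an end of the opposite edge
  \<open>p (j + 2) p (j + 3)\<close>, which puts it into a class. For consecutive classes, the edges
  \<open>u p (i + 4)\<close> and \<open>v p (i + 2)\<close> force \<open>u\<close> and
  \<open>v\<close> to be adjacent. Vertices in the same class or two classes apart share a neighbour
  on the pentagon, so an edge between them would close a triangle.\<close>

lemma exists_pentagonal:
  assumes tf: triangle_free and "\<not> bipartite_mg V m"
  shows "\<exists>h. pentagonal h"
proof -
  obtain p where p: "pentagon p"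
    using exists_pentagon[OF assms] by blast
  have tri: "\<not> a \<sim> c" if "a \<sim> b" "b \<sim> c" for a b c
    using tf that by (auto simp: triangle_free_def)
  have p_cong: "p i = p j" if "i mod 5 = j mod 5" for i j
    using p that unfolding pentagon_def by metis
  have step: "p i \<sim> p j" if "(i + 1) mod 5 = j mod 5" for i j
  proof -
    have "p i \<sim> p (i + 1)" using p unfolding pentagon_def by blast
    then show ?thesis using p_cong[OF that] by simp
  qed
  have common: "\<not> a \<sim> b" if "a \<sim> c" "b \<sim> c" for a b c
    using tri[of a c b] that edge_sym[of b c] by blast
  have pc: "v \<in> pclass p i \<longleftrightarrow> v \<sim> p (i + 1) \<and> v \<sim> p (i + 4)" for v i
    using edge_in_V by (auto simp: pclass_def)
  have class_mod: "pclass p (i mod 5) = pclass p i" for i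
    using p_cong[of "i mod 5 + 1" "i + 1"] p_cong[of "i mod 5 + 4" "i + 4"]
    by (simp add: pclass_def mod_simps)
  have class_of_nb: "v \<in> pclass p (j + 1) \<or> v \<in> pclass p (j + 4)" if v: "v \<sim> p j" for v j
  proof -
    have e: "p j \<sim> p (j + 1)" "p (j + 1) \<sim> p (j + 2)" "p (j + 2) \<sim> p (j + 3)"
      "p (j + 3) \<sim> p (j + 4)" "p (j + 4) \<sim> p j"
      by (rule step; presburger)+
    have "\<not> p j \<sim> p (j + 2)" "\<not> p j \<sim> p (j + 3)"
      using tri[OF e(1,2)] tri[OF e(4,5)] edge_sym by blast+
    then have "v \<sim> p (j + 2) \<or> v \<sim> p (j + 3)"
      using no_2K2[OF v e(3)] by blast
    moreover have "p (j + 1 + 4) = p j" "p (j + 4 + 1) = p j" "p (j + 4 + 4) = p (j + 3)"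
      "p (j + 1 + 1) = p (j + 2)"
      by (rule p_cong; presburger)+
    ultimately show ?thesis
      using v unfolding pc by metis
  qed
  have same: "\<not> u \<sim> v" if "u \<in> pclass p i" "v \<in> pclass p i" for u v i
    using that common unfolding pc by blast
  have apart: "\<not> u \<sim> v" if "u \<in> pclass p i" "v \<in> pclass p (i + 2)" for u v i
  proof -
    have "p (i + 2 + 4) = p (i + 1)" by (rule p_cong) presburger
    then show ?thesis using that common unfolding pc by metis
  qed
  have next_class: "u \<sim> v" if u: "u \<in> pclass p i" and v: "v \<in> pclass p (i + 1)" for u v i
  proof -
    have e: "p (i + 1) \<sim> p (i + 2)" "p (i + 4) \<sim> p i" "p (i + 2) \<sim> p (i + 3)" "p (i + 3) \<sim> p (i + 4)"
      by (rule step; presburger)+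
    have "p (i + 1 + 1) = p (i + 2)" "p (i + 1 + 4) = p i"
      by (rule p_cong; presburger)+
    then have uv: "u \<sim> p (i + 1)" "u \<sim> p (i + 4)" "v \<sim> p (i + 2)" "v \<sim> p i"
      using u v unfolding pc by simp_all
    have "\<not> u \<sim> p (i + 2)" "\<not> p (i + 4) \<sim> v" "\<not> p (i + 4) \<sim> p (i + 2)"
      using tri[OF uv(1) e(1)] common[OF e(2) uv(4)] tri[OF e(3,4)] edge_sym by blast+
    then show ?thesis
      using no_2K2[OF uv(2,3)] by blast
  qed
  have apart_disjoint: "v \<notin> pclass p (i + 2)" if v: "v \<in> pclass p i" for v i
  proof
    assume "v \<in> pclass p (i + 2)"
    moreover have "p (i + 3) \<sim> p (i + 4)" by (rule step) presburger
    moreover have "p (i + 2 + 1) = p (i + 3)" by (rule p_cong) presburger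
    ultimately show False using v tri unfolding pc by metis
  qed
  \<comment> \<open>An edge leaving the set of vertices that see the pentagon would start in some
    class \<open>i\<close> and form an induced 2K2 with \<open>p (i + 2) p (i + 3)\<close>.\<close>
  have W: "\<exists>j. v \<sim> p j" if "v \<in> V" for v
  proof (rule ccontr)
    assume neg: "\<not> ?thesis"
    define W where "W = {v \<in> V. \<exists>j. v \<sim> p j}"
    have "p 0 \<sim> p 1" by (rule step) simp
    then have "p 0 \<in> W" using edge_in_V by (auto simp: W_def)
    moreover have "W \<subseteq> V" "v \<in> V - W"
      using neg \<open>v \<in> V\<close> by (auto simp: W_def)
    ultimately obtain y z where yz: "y \<in> W" "z \<in> V - W" "y \<sim> z"
      using edge_leaving by blast
    then obtain i where i: "y \<in> pclass p i"
      using class_of_nb unfolding W_def by blast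
    have e: "p (i + 1) \<sim> p (i + 2)" "p (i + 2) \<sim> p (i + 3)" "p (i + 3) \<sim> p (i + 4)"
      by (rule step; presburger)+
    have "\<not> y \<sim> p (i + 2)" "\<not> y \<sim> p (i + 3)"
      using i tri[OF _ e(1)] common[OF _ e(3)] unfolding pc by blast+
    moreover have "\<not> z \<sim> p j" for j
      using yz by (auto simp: W_def)
    ultimately show False
      using no_2K2[OF yz(3) e(2)] by blast
  qed
  have "\<exists>i<5. v \<in> pclass p i" if v: "v \<in> V" for v
  proof -
    obtain i where "v \<in> pclass p i"
      using W[OF v] class_of_nb by blast
    then show ?thesis
      by (intro exI[of _ "i mod 5"]) (simp add: class_mod)
  qed
  then obtain h where h: "\<And>v. v \<in> V \<Longrightarrow> h v < 5" "\<And>v. v \<in> V \<Longrightarrow> v \<in> pclass p (h v)"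
    by metis
  \<comment> \<open>A vertex in two consecutive classes would be adjacent to itself by
    \<open>next_class\<close>; one in two classes at distance two would form a triangle with a
    pentagon edge.\<close>
  have unique: "i = j" if "v \<in> pclass p i" "v \<in> pclass p j" "i < 5" "j < 5" for v i j
    using five_cases[OF that(3,4)] that next_class[of v i v] next_class[of v j v]
      apart_disjoint[of v i] apart_disjoint[of v j] class_mod[of "i + 1"] class_mod[of "j + 1"]
      class_mod[of "i + 2"] class_mod[of "j + 2"] edge_irrefl by metis
  have "u \<sim> v \<longleftrightarrow> consecutive (h u) (h v)" if uv: "u \<in> V" "v \<in> V" for u v
  proof -
    have "consecutive i j \<Longrightarrow> j \<noteq> i \<and> j \<noteq> (i + 2) mod 5 \<and> i \<noteq> (j + 2) mod 5"
      if "i < 5" "j < 5" for i j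
      using that unfolding less_five consecutive_def by (elim disjE) simp_all
    then have nc: "consecutive (h u) (h v) \<Longrightarrow>
        h v \<noteq> h u \<and> h v \<noteq> (h u + 2) mod 5 \<and> h u \<noteq> (h v + 2) mod 5"
      using h(1) uv by blast
    show ?thesis
      using five_cases[OF h(1)[OF uv(1)] h(1)[OF uv(2)]]
    proof (elim disjE)
      assume "h v = h u"
      then show ?thesis using same[of u "h u" v] h(2) uv nc by metis
    next
      assume "h v = (h u + 1) mod 5"
      then show ?thesis
        using next_class[of u "h u" v] h(2) uv class_mod unfolding consecutive_def by metis
    next
      assume "h u = (h v + 1) mod 5"
      then show ?thesis
        using next_class[of v "h v" u] h(2) uv class_mod edge_sym unfolding consecutive_def by metis
    next
      assume "h v = (h u + 2) mod 5"
      then show ?thesis using apart[of u "h u" v] h(2) uv class_mod nc by metis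
    next
      assume "h u = (h v + 2) mod 5"
      then show ?thesis using apart[of v "h v" u] h(2) uv class_mod nc edge_sym by metis
    qed
  qed
  moreover have "\<exists>v\<in>V. h v = i" if "i < 5" for i
  proof -
    have e: "p i \<sim> p (i + 1)" "p (i + 4) \<sim> p i"
      by (rule step; presburger)+
    then have "p i \<in> pclass p i" "p i \<in> V"
      unfolding pc using edge_sym edge_in_V by blast+
    then have "h (p i) = i"
      using unique[OF h(2) _ h(1) that] by blast
    then show ?thesis using \<open>p i \<in> V\<close> by blast
  qed
  ultimately show ?thesis
    using h(1) unfolding pentagonal_def by blast
qed

lemma pentagonal_card_nb:
  assumes h: "pentagonal h" and x: "x \<in> V"
  shows "card (nb x) = card {v \<in> V. h v = (h x + 1) mod 5} + card {v \<in> V. h v = (h x + 4) mod 5}"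
proof -
  have cons: "consecutive i j \<longleftrightarrow> j = (i + 1) mod 5 \<or> j = (i + 4) mod 5" if "i < 5" "j < 5" for i j
    using that unfolding less_five consecutive_def by (elim disjE) simp_all
  have "y \<in> nb x \<longleftrightarrow> y \<in> V \<and> (h y = (h x + 1) mod 5 \<or> h y = (h x + 4) mod 5)" for y
  proof (cases "y \<in> V")
    case True
    then have "x \<sim> y \<longleftrightarrow> consecutive (h x) (h y)" "h x < 5" "h y < 5"
      using h x unfolding pentagonal_def by blast+
    then show ?thesis using cons True by simp
  next
    case False
    then show ?thesis using edge_in_V[of x y] by auto
  qed
  then have "nb x = {v \<in> V. h v = (h x + 1) mod 5} \<union> {v \<in> V. h v = (h x + 4) mod 5}"
    by blast
  moreover have "{v \<in> V. h v = a} \<inter> {v \<in> V. h v = b} = {}" if "a \<noteq> b" for a b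
    using that by auto
  moreover have "(h x + 1) mod 5 \<noteq> (h x + 4) mod 5"
    by presburger
  ultimately show ?thesis
    by (simp add: card_Un_disjoint)
qed

lemma pentagonal_card:
  assumes "pentagonal h"
  shows "card V = (\<Sum>i<5. card {v \<in> V. h v = i})"
proof -
  have "(\<Sum>i<5. \<Sum>v\<in>{v \<in> V. h v = i}. 1) = (\<Sum>v\<in>V. 1 :: nat)"
    using assms by (intro sum.group) (auto simp: pentagonal_def)
  then show ?thesis by simp
qed

text \<open>For odd \<open>D\<close> the degree bounds leave open where the two large classes sit; a
  rotation moves them to the indices 0 and 1 prescribed by \<open>c5_size\<close>.\<close>

lemma pentagonal_rotate:
  assumes h: "pentagonal h" and t: "t < 5"
    and n: "\<And>i. i < 5 \<Longrightarrow> card {v \<in> V. h v = i} = s ((i + t) mod 5)"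
  obtains h' where "pentagonal h'" "\<And>i. i < 5 \<Longrightarrow> card {v \<in> V. h' v = i} = s i"
proof
  define h' where "h' v = (h v + t) mod 5" for v
  have h5: "h v < 5" if "v \<in> V" for v
    using h that by (simp add: pentagonal_def)
  have shift: "(j + t) mod 5 = i \<longleftrightarrow> j = (i + 5 - t) mod 5" if "i < 5" "j < 5" for i j
    using that t unfolding less_five by (elim disjE) simp_all
  have unshift: "((i + 5 - t) mod 5 + t) mod 5 = i" if "i < 5" for i
    using that t unfolding less_five by (elim disjE) simp_all
  have fibre: "{v \<in> V. h' v = i} = {v \<in> V. h v = (i + 5 - t) mod 5}" if "i < 5" for i
    using shift[OF that h5] by (auto simp: h'_def)
  show "card {v \<in> V. h' v = i} = s i" if "i < 5" for i
    using n[of "(i + 5 - t) mod 5"] unshift[OF that] fibre[OF that] by simp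
  have cons: "consecutive ((i + t) mod 5) ((j + t) mod 5) \<longleftrightarrow> consecutive i j" if "i < 5" "j < 5" for i j
    using that t unfolding less_five consecutive_def by (elim disjE) simp_all
  have "\<exists>v\<in>V. h' v = i" if "i < 5" for i
  proof -
    have "(i + 5 - t) mod 5 < 5" by simp
    then obtain v where "v \<in> V" "h v = (i + 5 - t) mod 5"
      using h unfolding pentagonal_def by blast
    then show ?thesis using fibre[OF that] by blast
  qed
  then show "pentagonal h'"
    using h cons h5 by (simp add: pentagonal_def h'_def)
qed

end

text \<open>The five bounds add up to \<open>2 * (n 0 + ... + n 4) <= 5 * D\<close>, so the total
  slack is at most 1. For even \<open>D\<close> parity makes every bound tight, and tight bounds
  around an odd cycle have a single solution. For odd \<open>D\<close> exactly one unit is lost,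
  which leaves five rotations.\<close>

lemma five_sizes:
  fixes n :: "nat \<Rightarrow> nat"
  assumes le: "\<And>i. i < 5 \<Longrightarrow> n ((i + 1) mod 5) + n ((i + 4) mod 5) \<le> D"
    and sum: "5 * D \<le> 2 * (\<Sum>i<5. n i) + 1"
  shows "\<exists>t<5. \<forall>i<5. n i = c5_size D ((i + t) mod 5)"
proof -
  have le5: "n 1 + n 4 \<le> D" "n 2 + n 0 \<le> D" "n 3 + n 1 \<le> D" "n 4 + n 2 \<le> D" "n 0 + n 3 \<le> D"
    using le[of 0] le[of 1] le[of 2] le[of 3] le[of 4] by (simp_all add: numeral_2_eq_2)
  have sum5: "5 * D \<le> 2 * n 0 + 2 * n 1 + 2 * n 2 + 2 * n 3 + 2 * n 4 + 1"
    using sum by (simp add: lessThan_five)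
  have all5: "(\<forall>i<5. P i) \<longleftrightarrow> P 0 \<and> P 1 \<and> P 2 \<and> P 3 \<and> P (4::nat)" for P
    using lessThan_five by (metis empty_iff insert_iff lessThan_iff)
  show ?thesis
  proof (cases "even D")
    case True
    then obtain k where D: "D = 2 * k" by blast
    have "n 0 = k \<and> n 1 = k \<and> n 2 = k \<and> n 3 = k \<and> n 4 = k"
      using le5 sum5 unfolding D by (intro conjI order_antisym; linarith)
    then show ?thesis
      by (intro exI[of _ 0]) (simp add: all5 c5_size_def D)
  next
    case False
    then obtain k where D: "D = 2 * k + 1" by (elim oddE)
    \<comment> \<open>The bounded pairs form a five-cycle. Deleting one index leaves two disjoint
      pairs, each of sum at most \<open>2 * k + 1\<close>, while the total is at least
      \<open>5 * k + 2\<close>.\<close>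
    have ge: "k \<le> n 0 \<and> k \<le> n 1 \<and> k \<le> n 2 \<and> k \<le> n 3 \<and> k \<le> n 4"
      using le5 sum5 unfolding D distrib_left by (intro conjI; linarith)
    have "(n 0 = k \<or> n 0 = k + 1) \<and> (n 1 = k \<or> n 1 = k + 1) \<and> (n 2 = k \<or> n 2 = k + 1) \<and>
      (n 3 = k \<or> n 3 = k + 1) \<and> (n 4 = k \<or> n 4 = k + 1)"
      using le5 ge unfolding D by (intro conjI; linarith)
    \<comment> \<open>Classes at distance two cannot both exceed \<open>k\<close>, and the total
      demands two that do; so exactly two consecutive classes are large.\<close>
    then consider
        "n 0 = k + 1" "n 1 = k + 1" "n 2 = k" "n 3 = k" "n 4 = k"
      | "n 0 = k" "n 1 = k + 1" "n 2 = k + 1" "n 3 = k" "n 4 = k"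
      | "n 0 = k" "n 1 = k" "n 2 = k + 1" "n 3 = k + 1" "n 4 = k"
      | "n 0 = k" "n 1 = k" "n 2 = k" "n 3 = k + 1" "n 4 = k + 1"
      | "n 0 = k + 1" "n 1 = k" "n 2 = k" "n 3 = k" "n 4 = k + 1"
      using le5 sum5 unfolding D distrib_left by (elim conjE disjE; simp)
    then show ?thesis
    proof cases
      case 1
      then show ?thesis by (intro exI[of _ 0]) (simp add: all5 c5_size_def D)
    next
      case 2
      then show ?thesis by (intro exI[of _ 4]) (simp add: all5 c5_size_def D)
    next
      case 3
      then show ?thesis by (intro exI[of _ 3]) (simp add: all5 c5_size_def D)
    next
      case 4
      then show ?thesis by (intro exI[of _ 2]) (simp add: all5 c5_size_def D)
    next
      case 5
      then show ?thesis by (intro exI[of _ 1]) (simp add: all5 c5_size_def D)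
    qed
  qed
qed

section \<open>Equality with the blown-up five-cycle\<close>

context two_K2_free_mg
begin

theorem triangle_free_num_edges:
  assumes "2 \<le> D" triangle_free "\<not> bipartite_mg V m"
  shows "num_edges V m < fD D \<or> mg_iso V m (C5_V D) (C5_m D)"
proof -
  obtain h where h: "pentagonal h"
    using exists_pentagonal assms by blast
  show ?thesis
  proof (cases "2 * card V + 2 \<le> 5 * D")
    case True
    then have "D * (2 * card V + 2) \<le> D * (5 * D)"
      by (rule mult_le_mono2)
    then have "4 * num_edges V m + 2 * D \<le> 5 * D\<^sup>2"
      using num_edges_le_card by (simp add: power2_eq_square algebra_simps)
    then show ?thesis using less_fD assms(1) by blast
  next
    case False
    have "card {v \<in> V. h v = (i + 1) mod 5} + card {v \<in> V. h v = (i + 4) mod 5} \<le> D"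
      if i: "i < 5" for i
    proof -
      obtain x where x: "x \<in> V" "h x = i"
        using h i unfolding pentagonal_def by blast
      then show ?thesis
        using pentagonal_card_nb[OF h x(1)] card_nb_le[OF x(1)] by simp
    qed
    moreover have "5 * D \<le> 2 * (\<Sum>i<5. card {v \<in> V. h v = i}) + 1"
      using False pentagonal_card[OF h] by linarith
    ultimately obtain t where t: "t < 5" "\<And>i. i < 5 \<Longrightarrow> card {v \<in> V. h v = i} = c5_size D ((i + t) mod 5)"
      using five_sizes[of "\<lambda>i. card {v \<in> V. h v = i}" D] by auto
    obtain h' where h': "pentagonal h'" "\<And>i. i < 5 \<Longrightarrow> card {v \<in> V. h' v = i} = c5_size D i"
      using pentagonal_rotate[OF h t] by blast
    have h'5: "h' v < 5" if "v \<in> V" for v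
      using h'(1) that by (simp add: pentagonal_def)
    \<comment> \<open>For odd \<open>D\<close> class 3 alone, between the small classes 2 and 4,
      falls short of \<open>D\<close> neighbours. It is stable, so each edge still has an end to
      which \<open>multiplicity_one\<close> applies.\<close>
    have full: "D \<le> card (nb x)" if x: "x \<in> V" "h' x \<noteq> 3" for x
    proof -
      have "card (nb x) = c5_size D ((h' x + 1) mod 5) + c5_size D ((h' x + 4) mod 5)"
        using pentagonal_card_nb[OF h'(1) x(1)] h'(2) by simp
      moreover have "h' x = 0 \<or> h' x = 1 \<or> h' x = 2 \<or> h' x = 4"
        using h'5[OF x(1)] x(2) by linarith
      ultimately show ?thesis
        by (elim disjE) (auto simp: c5_size_def elim!: evenE oddE)
    qed
    have full3: "D \<le> card (nb x) \<or> D \<le> card (nb y)" if "x \<sim> y" for x y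
    proof -
      have "consecutive (h' x) (h' y)"
        using h'(1) that edge_in_V[OF that] by (simp add: pentagonal_def)
      then have "h' x \<noteq> 3 \<or> h' y \<noteq> 3"
        by (auto simp: consecutive_def)
      then show ?thesis using full edge_in_V[OF that] by blast
    qed
    have simple: "m x y = of_bool (consecutive (h' x) (h' y))" if xy: "x \<in> V" "y \<in> V" for x y
    proof (cases "x \<sim> y")
      case True
      then have "m x y = 1"
        using full3[OF True] multiplicity_one[of x y] multiplicity_one[of y x] xy edge_sym[of x y]
          m_commute[of x y] by auto
      then show ?thesis
        using True h'(1) xy by (simp add: pentagonal_def)
    next
      case False
      then have "\<not> consecutive (h' x) (h' y)"
        using h'(1) xy by (simp add: pentagonal_def)
      then show ?thesis
        using False by (simp add: adj_def)
    qed
    obtain f where f: "bij_betw f V {(i, j). i < 5 \<and> j < c5_size D i}" "\<And>v. v \<in> V \<Longrightarrow> fst (f v) = h' v"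
      using class_bijection[OF finite_V h'5 h'(2)] by blast
    have "m x y = C5_m D (f x) (f y)" if xy: "x \<in> V" "y \<in> V" for x y
    proof -
      have "f x \<in> C5_V D" "f y \<in> C5_V D"
        unfolding C5_V_def using xy by (simp_all only: bij_betw_apply[OF f(1)])
      then show ?thesis
        using simple[OF xy] f(2) xy by (simp add: C5_m_def consecutive_def)
    qed
    then have "mg_iso V m (C5_V D) (C5_m D)"
      using f(1) unfolding mg_iso_def C5_V_def by blast
    then show ?thesis by blast
  qed
qed

subsection \<open>Bipartite graphs\<close>

lemma dominated_side_card_le:
  assumes "A \<subseteq> V" "A \<noteq> {}"
    and "\<And>x y. x \<in> A \<Longrightarrow> y \<in> A \<Longrightarrow> \<not> x \<sim> y" "\<And>x y. x \<in> B \<Longrightarrow> y \<in> B \<Longrightarrow> \<not> x \<sim> y"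
    and "\<And>y. y \<in> B \<Longrightarrow> \<exists>x\<in>A. y \<sim> x"
  shows "card B \<le> D"
proof -
  obtain p where p: "p \<in> A" "\<forall>y\<in>B. p \<sim> y"
    using nested_dominator[OF assms] by blast
  then have "B \<subseteq> nb p" by auto
  then have "card B \<le> card (nb p)" by (intro card_mono) auto
  then show ?thesis using card_nb_le[of p] p assms(1) by fastforce
qed

lemma num_edges_le_side:
  assumes "A \<subseteq> V" "\<And>x y. x \<sim> y \<Longrightarrow> x \<in> A \<or> y \<in> A"
  shows "num_edges V m \<le> (\<Sum>x\<in>A. mdeg V m x)"
proof -
  have "1 * num_edges V m \<le> (\<Sum>x\<in>V. of_bool (x \<in> A) * mdeg V m x)"
    by (rule num_edges_le_weighted) (use assms(2) in fastforce)
  also have "\<dots> = (\<Sum>x\<in>A. mdeg V m x)"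
    using assms(1) by (simp add: Int_absorb1)
  finally show ?thesis by simp
qed

text \<open>In the extremal case every neighbour of a vertex \<open>a\<close> of least neighbourhood sees the
  whole side of \<open>a\<close>, because neighbourhoods are nested.\<close>

theorem bipartite_num_edges:
  assumes "2 \<le> D" "bipartite_mg V m"
  shows "num_edges V m < D\<^sup>2 \<or> mg_iso V m (KDD_V D) (KDD_m D)"
proof (cases "\<exists>u v. u \<sim> v")
  case False
  then have "m u v = 0" for u v
    by (simp add: adj_def)
  then have "num_edges V m = 0"
    by (simp add: num_edges_def)
  then show ?thesis using assms(1) by simp
next
  case True
  then obtain u v where uv: "u \<sim> v" by blast
  obtain A where A: "A \<subseteq> V" and *: "\<forall>x\<in>V. \<forall>y\<in>V. x \<sim> y \<longrightarrow> (x \<in> A \<longleftrightarrow> y \<notin> A)"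
    using assms(2) unfolding bipartite_mg_def by blast
  have bip: "x \<in> A \<longleftrightarrow> y \<notin> A" if "x \<sim> y" for x y
    using * edge_in_V[OF that] that by blast
  define B where "B = V - A"
  have B: "B \<subseteq> V" and AB: "A \<inter> B = {}" "V = A \<union> B"
    using A by (auto simp: B_def)
  have fin: "finite A" "finite B"
    using A B finite_subset finite_V by blast+
  have cross: "x \<in> A \<and> y \<in> B \<or> x \<in> B \<and> y \<in> A" if "x \<sim> y" for x y
    using bip[OF that] edge_in_V[OF that] by (auto simp: B_def)
  have stA: "\<not> x \<sim> y" if "x \<in> A" "y \<in> A" for x y using bip that by blast
  have stB: "\<not> x \<sim> y" if "x \<in> B" "y \<in> B" for x y using bip that by (auto simp: B_def)
  have ne: "A \<noteq> {}" "B \<noteq> {}" using cross[OF uv] by blast+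
  have nbr: "\<exists>y. x \<sim> y" if x: "x \<in> V" for x
  proof -
    obtain w where "w \<in> V" "w \<noteq> x"
      using uv edge_in_V[OF uv] edge_irrefl by metis
    then show ?thesis
      using edge_leaving[of "{x}" x w] x by blast
  qed
  have nA: "\<exists>y\<in>B. x \<sim> y" if "x \<in> A" for x
    using nbr[of x] that A cross AB by blast
  have nB: "\<exists>y\<in>A. x \<sim> y" if "x \<in> B" for x
    using nbr[of x] that B cross AB by blast
  have cA: "card A \<le> D"
    using dominated_side_card_le[OF B ne(2) stB stA nA] .
  have cB: "card B \<le> D"
    using dominated_side_card_le[OF A ne(1) stA stB nB] .
  have sA: "num_edges V m \<le> (\<Sum>x\<in>A. mdeg V m x)"
    by (rule num_edges_le_side[OF A]) (use cross in blast)
  have sB: "num_edges V m \<le> (\<Sum>x\<in>B. mdeg V m x)"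
    by (rule num_edges_le_side[OF B]) (use cross in blast)
  have small: "num_edges V m < D\<^sup>2"
    if "num_edges V m \<le> (\<Sum>x\<in>C. mdeg V m x)" "C \<subseteq> V" "card C < D" for C
  proof -
    have "(\<Sum>x\<in>C. mdeg V m x) \<le> of_nat (card C) * D"
      using that mdeg_le by (intro sum_bounded_above) blast
    also have "\<dots> < D * D" using that assms(1) by simp
    finally show ?thesis using that by (simp add: power2_eq_square)
  qed
  consider "card A < D" | "card B < D" | "card A = D" "card B = D"
    using cA cB by linarith
  then show ?thesis
  proof cases
    case 1
    then show ?thesis using small[OF sA A] by blast
  next
    case 2
    then show ?thesis using small[OF sB B] by blast
  next
    case 3
    show ?thesis
    proof (cases "\<exists>a\<in>A. mdeg V m a < D")
      case True
      then have "(\<Sum>x\<in>A. mdeg V m x) < (\<Sum>x\<in>A. D)"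
        using A mdeg_le fin by (intro sum_strict_mono_ex1) auto
      then show ?thesis using sA 3 by (simp add: power2_eq_square)
    next
      case False
      obtain a where a: "a \<in> A" "\<And>x. x \<in> A \<Longrightarrow> card (nb a) \<le> card (nb x)"
        using ex_has_least_nat[of "\<lambda>x. x \<in> A" _ "\<lambda>x. card (nb x)"] ne by blast
      have sees_A: "b \<sim> x" if b: "a \<sim> b" and x: "x \<in> A" for b x
      proof (rule ccontr)
        assume nbx: "\<not> b \<sim> x"
        then have "b \<in> nb a" "b \<notin> nb x" using b edge_sym by auto
        then have "\<not> nb x \<subset> nb a"
          using psubset_card_mono[of "nb a" "nb x"] a(2)[OF x] by auto
        then obtain c where c: "x \<sim> c" "\<not> a \<sim> c"
          using \<open>b \<in> nb a\<close> \<open>b \<notin> nb x\<close> in_nb by blast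
        have "\<not> b \<sim> c" using cross[OF b] cross[OF c(1)] a(1) x AB stB by blast
        then show False using no_2K2[OF b c(1)] stA[OF a(1) x] c(2) nbx by blast
      qed
      \<comment> \<open>Every neighbour of \<open>a\<close> sees all \<open>D\<close> vertices of
        \<open>A\<close>, so the edges at \<open>a\<close> are simple. As \<open>a\<close> has
        degree at least \<open>D\<close>, it has \<open>D\<close> distinct neighbours, and by the
        choice of \<open>a\<close> so has every vertex of \<open>A\<close>.\<close>
      have "m a b = of_bool (a \<sim> b)" for b
      proof (cases "a \<sim> b")
        case True
        have "A \<subseteq> nb b" using sees_A[OF True] by auto
        then have "D \<le> card (nb b)" using 3 card_mono[of "nb b" A] by simp
        then have "m b a = 1"
          using multiplicity_one[of b a] True edge_in_V[OF True] edge_sym by blast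
        then show ?thesis using True m_commute by simp
      qed (simp add: adj_def)
      then have "mdeg V m a = card (nb a)"
        by (simp add: mdeg_def nb_def Int_def)
      moreover have "\<not> mdeg V m a < D" using False a(1) by blast
      ultimately have Da: "D \<le> card (nb x)" if "x \<in> A" for x
        using a(2)[OF that] by linarith
      have nbA: "nb x = B" if x: "x \<in> A" for x
      proof (rule card_seteq)
        show "nb x \<subseteq> B"
        proof
          fix y assume "y \<in> nb x"
          then have "x \<sim> y" by simp
          then show "y \<in> B" using cross x AB(1) by blast
        qed
        show "card B \<le> card (nb x)" using Da[OF x] 3 by simp
      qed (rule fin)
      have one: "m x y = 1" if "x \<in> A" "y \<in> B" for x y
        using multiplicity_one[of x y] Da nbA[OF that(1)] that A in_nb[of y x] by blast
      define h where "h x = (if x \<in> A then 0 else 1 :: nat)" for x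
      have hm: "m x y = of_bool (h x \<noteq> h y)" if "x \<in> V" "y \<in> V" for x y
      proof (cases "h x = h y")
        case True
        then have "\<not> x \<sim> y" using stA stB that by (auto simp: h_def B_def split: if_splits)
        then show ?thesis using True by (simp add: adj_def)
      next
        case False
        then show ?thesis
          using one[of x y] one[of y x] m_commute[of x y] that by (auto simp: h_def B_def split: if_splits)
      qed
      have "{v \<in> V. h v = 0} = A" "{v \<in> V. h v = 1} = B"
        using A by (auto simp: h_def B_def)
      then have "card {v \<in> V. h v = i} = D" if "i < 2" for i
        using that 3 by (auto simp: less_2_cases_iff)
      moreover have "h v < 2" for v by (simp add: h_def)
      ultimately obtain f where f: "bij_betw f V {(i, j). i < 2 \<and> j < D}"
        "\<And>v. v \<in> V \<Longrightarrow> fst (f v) = h v"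
        using class_bijection[of V h 2 "\<lambda>_. D"] finite_V by blast
      have "m x y = KDD_m D (f x) (f y)" if xy: "x \<in> V" "y \<in> V" for x y
      proof -
        have "f x \<in> KDD_V D" "f y \<in> KDD_V D"
          unfolding KDD_V_def using xy by (simp_all only: bij_betw_apply[OF f(1)])
        then show ?thesis
          using hm[OF xy] f(2) xy by (simp add: KDD_m_def)
      qed
      then have "mg_iso V m (KDD_V D) (KDD_m D)"
        using f(1) unfolding mg_iso_def KDD_V_def by blast
      then show ?thesis by blast
    qed
  qed
qed

end

theorem mainTheorem13:
  fixes V :: "'a set" and m :: "'a \<Rightarrow> 'a \<Rightarrow> nat" and D :: nat
  assumes "2 \<le> D"
    and "loopless_multigraph V m"
    and "\<forall>x\<in>V. mdeg V m x \<le> D"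
    and "connected_mg V m"
    and "two_K2_free V m"
  shows "(bipartite_mg V m \<longrightarrow>
            num_edges V m \<le> D^2 \<and> (num_edges V m = D^2 \<longleftrightarrow> mg_iso V m (KDD_V D) (KDD_m D)))
       \<and> (clique_number V m = 2 \<and> \<not> bipartite_mg V m \<longrightarrow>
            num_edges V m \<le> fD D \<and> (num_edges V m = fD D \<longleftrightarrow> mg_iso V m (C5_V D) (C5_m D)))
       \<and> (3 \<le> clique_number V m \<longrightarrow> num_edges V m < fD D)"
proof -
  interpret two_K2_free_mg V m D
    using assms by unfold_locales auto
  have bip: "num_edges V m < D\<^sup>2 \<or> mg_iso V m (KDD_V D) (KDD_m D)" if "bipartite_mg V m"
    using bipartite_num_edges assms(1) that by blast
  have KDD: "num_edges V m = D\<^sup>2" if "mg_iso V m (KDD_V D) (KDD_m D)"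
    using mg_iso_num_edges[OF that] num_edges_KDD by simp
  have pent: "num_edges V m < fD D \<or> mg_iso V m (C5_V D) (C5_m D)"
    if "clique_number V m = 2" "\<not> bipartite_mg V m"
  proof -
    have triangle_free
      unfolding triangle_free_def
    proof (intro allI impI notI)
      fix a b c assume abc: "adj m a b" "adj m b c" "adj m a c"
      then have "is_clique V m {a, b, c}"
        using edge_in_V edge_sym by (auto simp: is_clique_def)
      moreover have "card {a, b, c} = 3"
        using abc by (auto simp: card_insert_if)
      ultimately show False
        using card_clique_le[of "{a, b, c}"] that(1) by simp
    qed
    then show ?thesis
      using triangle_free_num_edges[OF assms(1)] that(2) by blast
  qed
  have C5: "num_edges V m = fD D" if "mg_iso V m (C5_V D) (C5_m D)"
    using mg_iso_num_edges[OF that] num_edges_C5 by simp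
  have "num_edges V m < fD D" if "3 \<le> clique_number V m"
    using less_fD[OF assms(1) large_clique_num_edges[OF assms(1) that]] .
  then show ?thesis
    using bip KDD pent C5 by fastforce
qed

end
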